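(* Assume that $b:\mathbb{R}^2\to\mathbb{R}^2$ and $\sigma:\mathbb{R}^2\to M_2(\mathbb{R})$ are differentiable and bounded together with their derivatives, and that $\alpha:\mathbb{R}^2\to\mathbb{R}$ is differentiable and bounded together with its derivative and satisfies $\inf_{q\in\mathbb{R}^2}\alpha(q)=\alpha_0>0$. Let $A(q)=\alpha(q)A_0$, fix $q_0,p_0\in\mathbb{R}^2$, let $w^\delta$ be the mollified Wiener process, and let $(q^{\mu,\delta}_t,p^{\mu,\delta}_t)$ be the solution of $$\dot q^{\mu,\delta}_t=p^{\mu,\delta}_t,\qquad \mu\,\dot p^{\mu,\delta}_t=b(q^{\mu,\delta}_t)+A(q^{\mu,\delta}_t)\,p^{\mu,\delta}_t+\sigma(q^{\mu,\delta}_t)\,\dot w^\delta_t,\qquad q^{\mu,\delta}_0=q_0,\quad p^{\mu,\delta}_0=p_0.$$ Let $q^\delta_t$ be the solution of the first order differential equation $$\dot q^\delta_t=-A^{-1}(q^\delta_t)\,b(q^\delta_t)-A^{-1}(q^\delta_t)\,\sigma(q^\delta_t)\,\dot w^\delta_t,\qquad q^\delta_0=q_0.$$ Then there exists a constant $C>0$ (not depending on $\mu$, $\delta$, $T$) such that for any $T>0$, any $0<\mu\le 1$ and any $0<\delta\le 1$, $$E\max_{0\le t\le T}|q^{\mu,\delta}_t-q^\delta_t|\le C(1+T)^{\frac{11}{2}}\exp\left(\frac{C}{\delta^2}(1+T)^3\right)\mu.$$ In particular, for any fixed $0<\delta\le 1$, $$\lim_{\mu\downarrow 0}E\max_{0\le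 t\le T}|q^{\mu,\delta}_t-q^\delta_t|=0.$$
   Context: $|\cdot|$ is the Euclidean norm, $E$ is expectation, and $A_0=\begin{pmatrix}0&-1\\1&0\end{pmatrix}$. $w_t$ ($t\ge 0$) is a standard two-dimensional Wiener process (started at $0$). For $\delta>0$, the mollified process is $$w^\delta_t=\frac1\delta\int_0^\infty w_s\,\rho\left(\frac{s-t}{\delta}\right)ds,$$ where $\rho\ge 0$ is a fixed smooth function on $\mathbb{R}$ supported in $[0,1]$ with $\int_0^1\rho(s)\,ds=1$. Thus $w^\delta$ has smooth paths, and the equations driven by $\dot w^\delta$ are ordinary differential equations solved path by path. $A^{-1}(q)=\alpha(q)^{-1}A_0^{-1}$ is the matrix inverse. *)

theory Defs
  imports "HOL-Probability.Probability"
begin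

text \<open>Sure (not merely almost sure) continuity of the paths is part of the definition, so that
  equations driven by the mollified paths can be solved for every \<open>\<omega>\<close>.  The density below is that of
  the centred Gaussian law with covariance matrix \<open>(t - s) I\<close>; the second parameter of
  \<^const>\<open>normal_density\<close> is the standard deviation.\<close>

definition standard_wiener_process :: "'w measure \<Rightarrow> (real \<Rightarrow> 'w \<Rightarrow> real ^ 'n) \<Rightarrow> bool" where
  "standard_wiener_process M w \<longleftrightarrow>
     prob_space M \<and>
     (\<forall>t\<ge>0. w t \<in> borel_measurable M) \<and>
     (\<forall>\<omega>\<in>space M. w 0 \<omega> = 0) \<and>
     (\<forall>\<omega>\<in>space M. continuous_on {0..} (\<lambda>t. w t \<omega>)) \<and>
     (\<forall>(n::nat) (\<tau>::nat \<Rightarrow> real). 0 \<le> \<tau> 0 \<and> mono_on {..n} \<tau> \<longrightarrow>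
        prob_space.indep_vars M (\<lambda>_. borel) (\<lambda>i \<omega>. w (\<tau> (Suc i)) \<omega> - w (\<tau> i) \<omega>) {..<n}) \<and>
     (\<forall>s t. 0 \<le> s \<and> s < t \<longrightarrow>
        distributed M lborel (\<lambda>\<omega>. w t \<omega> - w s \<omega>)
          (\<lambda>x. ennreal (\<Prod>i\<in>UNIV. normal_density 0 (sqrt (t - s)) (x $ i))))"

definition mollifier :: "(real \<Rightarrow> real) \<Rightarrow> bool" where
  "mollifier \<rho> \<longleftrightarrow>
     (\<forall>n. (deriv ^^ n) \<rho> differentiable_on UNIV) \<and>
     (\<forall>x. 0 \<le> \<rho> x) \<and>
     (\<forall>x. x \<notin> {0..1} \<longrightarrow> \<rho> x = 0) \<and>
     (LINT s:{0..1}|lborel. \<rho> s) = 1"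

definition mollify ::
    "(real \<Rightarrow> real) \<Rightarrow> real \<Rightarrow> (real \<Rightarrow> 'a::euclidean_space) \<Rightarrow> real \<Rightarrow> 'a" where
  "mollify \<rho> \<delta> f t = (1 / \<delta>) *\<^sub>R (LINT s:{0..}|lborel. \<rho> ((s - t) / \<delta>) *\<^sub>R f s)"

definition mollified_velocity ::
    "(real \<Rightarrow> real) \<Rightarrow> real \<Rightarrow> (real \<Rightarrow> 'a::euclidean_space) \<Rightarrow> real \<Rightarrow> 'a" where
  "mollified_velocity \<rho> \<delta> f t = vector_derivative (mollify \<rho> \<delta> f) (at t within {0..})"

definition bounded_with_derivative ::
    "('a::real_normed_vector \<Rightarrow> 'b::real_normed_vector) \<Rightarrow> bool" where
  "bounded_with_derivative f \<longleftrightarrow>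
     (\<forall>x. f differentiable (at x)) \<and>
     bounded (range f) \<and>
     bdd_above (range (\<lambda>x. onorm (frechet_derivative f (at x))))"

definition A0 :: "real ^ 2 ^ 2" where
  "A0 = vector [vector [0, - 1], vector [1, 0]]"

text \<open>In the two predicates below, \<open>u\<close> is the (deterministic) driving velocity, to be
  instantiated by \<^const>\<open>mollified_velocity\<close> of a path; derivatives at \<open>0\<close> are one-sided.\<close>

definition second_order_solution ::
    "(real ^ 2 \<Rightarrow> real ^ 2) \<Rightarrow> (real ^ 2 \<Rightarrow> real ^ 2 ^ 2) \<Rightarrow> (real ^ 2 \<Rightarrow> real ^ 2 ^ 2) \<Rightarrow>
     real \<Rightarrow> (real \<Rightarrow> real ^ 2) \<Rightarrow> real ^ 2 \<Rightarrow> real ^ 2 \<Rightarrow>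
     (real \<Rightarrow> real ^ 2) \<Rightarrow> (real \<Rightarrow> real ^ 2) \<Rightarrow> bool" where
  "second_order_solution b A \<sigma> \<mu> u q0 p0 q p \<longleftrightarrow>
     q 0 = q0 \<and> p 0 = p0 \<and>
     (\<forall>t\<ge>0. (q has_vector_derivative p t) (at t within {0..}) \<and>
            (\<exists>p'. (p has_vector_derivative p') (at t within {0..}) \<and>
                  \<mu> *\<^sub>R p' = b (q t) + A (q t) *v p t + \<sigma> (q t) *v u t))"

definition first_order_solution ::
    "(real ^ 2 \<Rightarrow> real ^ 2) \<Rightarrow> (real ^ 2 \<Rightarrow> real ^ 2 ^ 2) \<Rightarrow> (real ^ 2 \<Rightarrow> real ^ 2 ^ 2) \<Rightarrow>
     (real \<Rightarrow> real ^ 2) \<Rightarrow> real ^ 2 \<Rightarrow> (real \<Rightarrow> real ^ 2) \<Rightarrow> bool" where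
  "first_order_solution b A \<sigma> u q0 q \<longleftrightarrow>
     q 0 = q0 \<and>
     (\<forall>t\<ge>0. (q has_vector_derivative
              (- (matrix_inv (A (q t)) *v b (q t)) - matrix_inv (A (q t)) *v (\<sigma> (q t) *v u t)))
              (at t within {0..}))"

end

theory Submission
  imports Defs
begin

text \<open>
  Why the theorem holds.  Write \<open>u\<close> for the velocity of the mollified path, and let \<open>z\<close> be the velocity
  that the first-order equation prescribes at the current position \<open>q\<close> of the second-order solution.
  The second-order equation says that \<open>\<mu> p'\<close> is \<open>A(q)\<close> applied to \<open>p - z\<close>.  Since \<open>A(q)\<close> is a multiple of the
  rotation by a right angle, the difference \<open>r = p - z\<close> rotates with a speed of order \<open>1 / \<mu>\<close>, but this
  rotation does not change its length; the length changes only through \<open>z'\<close>.  For smooth \<open>u\<close> Gronwall's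
  lemma bounds \<open>p\<close> independently of \<open>\<mu>\<close>.  Inserting \<open>p = z + \<mu> A\<inverse>(q) p'\<close> into \<open>q' = p\<close> and integrating the
  term with \<open>p'\<close> by parts shows that \<open>q\<close> solves the first-order equation up to an error of order \<open>\<mu>\<close>,
  and a second application of Gronwall's lemma gives \<open>|q - ql| = O(\<mu>)\<close>, where \<open>ql\<close> is the solution of the
  first-order equation.  This deterministic part is \<open>magnetic_relaxation_estimate\<close>.

  The constant is exponential in \<open>T\<close> times the size of \<open>u\<close>.  If \<open>X\<close> is the maximum of \<open>|w|\<close> on
  \<open>[0, T + 1]\<close>, then \<open>u\<close> is of order \<open>X / \<delta>\<close> and \<open>u'\<close> of order \<open>X / \<delta>\<^sup>2\<close>, so that the error on the path is at
  most \<open>C \<mu> exp (L (1 + T) (1 + X) / \<delta>)\<close>, with polynomial factors absorbed by the exponential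
  (\<open>pathwise_convergence_rate\<close>).  The expectation of \<open>exp (c X)\<close> is at most a constant times
  \<open>exp (2 c\<^sup>2 (1 + T))\<close> (\<open>wiener_exp_sup_moment\<close>): Doob's inequality applies to the exponential
  submartingales of the coordinates of \<open>w\<close> on a grid of times, and Fatou's lemma removes the grid.  With
  \<open>c\<close> of order \<open>(1 + T) / \<delta>\<close> this is the exponent \<open>(1 + T)\<^sup>3 / \<delta>\<^sup>2\<close> of the theorem.

  Integrability also requires that the maximal distance is measurable, although the solutions are
  given separately for each \<open>\<omega>\<close>.  They are pointwise limits of Euler schemes, which are measurable
  (\<open>borel_measurable_ode_solution\<close>), and the maximum of a continuous path is the limit of its maxima on
  grids.
\<close>

section \<open>A maximal inequality for products of independent factors\<close>

text \<open>Summation by parts, applied to the sum of the running maximum against the increments: an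
  increment of the maximum is multiplied by the value that creates it, so it contributes at least
  half of the increment of the squared maximum.\<close>

lemma running_max_summation_by_parts:
  fixes x :: "nat \<Rightarrow> real"
  shows "(Max (x ` {..n}))\<^sup>2 / 2 + (\<Sum>k<n. Max (x ` {..k}) * (x (Suc k) - x k))
           \<le> Max (x ` {..n}) * x n"
proof (induction n)
  case 0
  show ?case by (simp add: power2_eq_square)
next
  case (Suc n)
  define m where "m = Max (x ` {..n})"
  have step: "Max (x ` {..Suc n}) = max (x (Suc n)) m"
    by (simp add: atMost_Suc m_def)
  \<comment> \<open>The running maximum only moves at times at which it is attained by the current value.\<close>
  have jump: "((max (x (Suc n)) m)\<^sup>2 - m\<^sup>2) / 2 \<le> (max (x (Suc n)) m - m) * x (Suc n)"
  proof (cases "m \<le> x (Suc n)")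
    case True
    have "0 \<le> (x (Suc n) - m)\<^sup>2" by simp
    with True show ?thesis by (simp add: max_absorb1 power2_eq_square field_simps)
  next
    case False
    then show ?thesis by (simp add: max_absorb2)
  qed
  from Suc.IH jump show ?case
    unfolding step by (simp add: m_def[symmetric] algebra_simps diff_divide_distrib)
qed

text \<open>Doob's \<open>L\<^sup>2\<close> inequality for the submartingale of partial products of independent nonnegative
  factors of mean at least \<open>1\<close>.  Integrating the pathwise inequality above suffices: the stochastic
  sum in it has nonnegative expectation, because each of its terms is a nonnegative function of the
  past times an independent variable of nonnegative mean.\<close>

lemma (in prob_space) Doob_L2_product:
  fixes Y :: "nat \<Rightarrow> 'a \<Rightarrow> real"
  assumes ind: "indep_vars (\<lambda>_. borel) Y {..<n}"
    and sq: "\<And>i. i < n \<Longrightarrow> integrable M (\<lambda>\<omega>. (Y i \<omega>)\<^sup>2)"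
    and mean: "\<And>i. i < n \<Longrightarrow> 1 \<le> expectation (Y i)"
    and nonneg: "\<And>i \<omega>. 0 \<le> Y i \<omega>"
  shows "integrable M (\<lambda>\<omega>. (Max ((\<lambda>k. \<Prod>i<k. Y i \<omega>) ` {..n}))\<^sup>2)"
    and "expectation (\<lambda>\<omega>. (Max ((\<lambda>k. \<Prod>i<k. Y i \<omega>) ` {..n}))\<^sup>2)
           \<le> 4 * (\<Prod>i<n. expectation (\<lambda>\<omega>. (Y i \<omega>)\<^sup>2))"
proof -
  define X where "X k \<omega> = (\<Prod>i<k. Y i \<omega>)" for k \<omega>
  define m where "m k \<omega> = Max ((\<lambda>j. X j \<omega>) ` {..k})" for k \<omega>
  have Y_meas: "Y i \<in> borel_measurable M" if "i < n" for i
    using ind that by (auto simp: indep_vars_def)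
  have X_meas: "X k \<in> borel_measurable M" if "k \<le> n" for k
    unfolding X_def using that by (intro borel_measurable_prod Y_meas) auto
  have m_meas: "m k \<in> borel_measurable M" if "k \<le> n" for k
    unfolding m_def using that by (intro borel_measurable_Max X_meas) auto
  have X_nonneg: "0 \<le> X k \<omega>" for k \<omega>
    unfolding X_def by (intro prod_nonneg) (auto simp: nonneg)
  have m_ge: "X j \<omega> \<le> m k \<omega>" if "j \<le> k" for j k \<omega>
    unfolding m_def using that by (intro Max_ge) auto
  have m_nonneg: "0 \<le> m k \<omega>" for k \<omega>
    using m_ge[of 0 k \<omega>] X_nonneg[of 0 \<omega>] by linarith
  have m_le: "m k \<omega> \<le> (\<Sum>j\<le>k. X j \<omega>)" for k \<omega>
    unfolding m_def
    by (intro Max.boundedI) (auto intro!: member_le_sum simp: X_nonneg)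
  have X_sq: "integrable M (\<lambda>\<omega>. (X k \<omega>)\<^sup>2)"
     "expectation (\<lambda>\<omega>. (X k \<omega>)\<^sup>2) = (\<Prod>i<k. expectation (\<lambda>\<omega>. (Y i \<omega>)\<^sup>2))" if "k \<le> n" for k
  proof -
    have i: "indep_vars (\<lambda>_. borel) (\<lambda>i \<omega>. (Y i \<omega>)\<^sup>2) {..<k}"
      using that by (intro indep_vars_compose2[OF indep_vars_subset[OF ind]]) auto
    have e: "(X k \<omega>)\<^sup>2 = (\<Prod>i<k. (Y i \<omega>)\<^sup>2)" for \<omega>
      by (simp add: X_def prod_power_distrib)
    show "integrable M (\<lambda>\<omega>. (X k \<omega>)\<^sup>2)"
      unfolding e by (rule indep_vars_integrable[OF _ i]) (use that sq in auto)
    show "expectation (\<lambda>\<omega>. (X k \<omega>)\<^sup>2) = (\<Prod>i<k. expectation (\<lambda>\<omega>. (Y i \<omega>)\<^sup>2))"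
      unfolding e by (rule indep_vars_lebesgue_integral[OF _ i]) (use that sq in auto)
  qed
  have XX: "integrable M (\<lambda>\<omega>. X j \<omega> * X k \<omega>)" if "j \<le> n" "k \<le> n" for j k
  proof (rule Bochner_Integration.integrable_bound)
    show "integrable M (\<lambda>\<omega>. (X j \<omega>)\<^sup>2 + (X k \<omega>)\<^sup>2)"
      using that by (intro Bochner_Integration.integrable_add X_sq)
    show "(\<lambda>\<omega>. X j \<omega> * X k \<omega>) \<in> borel_measurable M"
      using that by (intro borel_measurable_times X_meas)
    have "X j \<omega> * X k \<omega> \<le> (X j \<omega>)\<^sup>2 + (X k \<omega>)\<^sup>2" for \<omega>
      using sum_squares_bound[of "X j \<omega>" "X k \<omega>"] X_nonneg[of j \<omega>] X_nonneg[of k \<omega>]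
        mult_nonneg_nonneg[OF X_nonneg[of j \<omega>] X_nonneg[of k \<omega>]] by linarith
    then show "AE \<omega> in M. norm (X j \<omega> * X k \<omega>) \<le> norm ((X j \<omega>)\<^sup>2 + (X k \<omega>)\<^sup>2)"
      by (simp add: X_nonneg)
  qed
  have mX: "integrable M (\<lambda>\<omega>. m k \<omega> * X j \<omega>)" if "j \<le> n" "k \<le> n" for j k
  proof (rule Bochner_Integration.integrable_bound)
    show "integrable M (\<lambda>\<omega>. \<Sum>i\<le>k. X i \<omega> * X j \<omega>)"
      using that by (intro Bochner_Integration.integrable_sum XX) auto
    show "(\<lambda>\<omega>. m k \<omega> * X j \<omega>) \<in> borel_measurable M"
      using that by (intro borel_measurable_times X_meas m_meas)
    have "m k \<omega> * X j \<omega> \<le> (\<Sum>i\<le>k. X i \<omega> * X j \<omega>)" for \<omega>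
      using mult_right_mono[OF m_le[of k \<omega>] X_nonneg[of j \<omega>]] by (simp add: sum_distrib_right)
    then show "AE \<omega> in M. norm (m k \<omega> * X j \<omega>) \<le> norm (\<Sum>i\<le>k. X i \<omega> * X j \<omega>)"
      by (simp add: X_nonneg m_nonneg sum_nonneg)
  qed
  \<comment> \<open>The submartingale property: the prefactor depends on the first \<open>k\<close> factors only, and what
    multiplies it is the independent variable \<open>Y k - 1\<close>, whose mean is nonnegative.\<close>
  have drift: "0 \<le> expectation (\<lambda>\<omega>. m k \<omega> * (X (Suc k) \<omega> - X k \<omega>))" if "k < n" for k
  proof -
    define f where "f z = Max ((\<lambda>j. \<Prod>i<j. z i) ` {..k}) * (\<Prod>i<k. z i)" for z :: "nat \<Rightarrow> real"
    have f: "f \<in> borel_measurable (PiM {..<k} (\<lambda>_. borel))"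
      unfolding f_def
      by (intro borel_measurable_times borel_measurable_Max borel_measurable_prod
          measurable_component_singleton) auto
    have "indep_var (PiM {..<k} (\<lambda>_. borel)) (\<lambda>\<omega>. restrict (\<lambda>i. Y i \<omega>) {..<k})
            (PiM {k} (\<lambda>_. borel)) (\<lambda>\<omega>. restrict (\<lambda>i. Y i \<omega>) {k})"
      by (intro indep_var_restrict[OF ind]) (use that in auto)
    from indep_var_compose[OF this f, of "\<lambda>z. z k - 1" borel]
    have i: "indep_var borel (f \<circ> (\<lambda>\<omega>. restrict (\<lambda>i. Y i \<omega>) {..<k}))
        borel ((\<lambda>z. z k - 1) \<circ> (\<lambda>\<omega>. restrict (\<lambda>i. Y i \<omega>) {k}))"
      by auto
    have e1: "f \<circ> (\<lambda>\<omega>. restrict (\<lambda>i. Y i \<omega>) {..<k}) = (\<lambda>\<omega>. m k \<omega> * X k \<omega>)"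
      unfolding f_def m_def X_def
      by (auto simp: fun_eq_iff intro!: arg_cong2[where f="(*)"] arg_cong[where f=Max] image_cong
          prod.cong)
    have e2: "(\<lambda>z. z k - 1) \<circ> (\<lambda>\<omega>. restrict (\<lambda>i. Y i \<omega>) {k}) = (\<lambda>\<omega>. Y k \<omega> - 1)"
      by (auto simp: fun_eq_iff)
    have Yi: "integrable M (Y k)"
      using square_integrable_imp_integrable[OF Y_meas sq] that by auto
    have "expectation (\<lambda>\<omega>. (m k \<omega> * X k \<omega>) * (Y k \<omega> - 1))
        = expectation (\<lambda>\<omega>. m k \<omega> * X k \<omega>) * expectation (\<lambda>\<omega>. Y k \<omega> - 1)"
      using that Yi by (intro indep_var_lebesgue_integral i[unfolded e1 e2] mX) auto
    moreover have "0 \<le> expectation (\<lambda>\<omega>. m k \<omega> * X k \<omega>)"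
      by (simp add: m_nonneg X_nonneg)
    moreover have "0 \<le> expectation (\<lambda>\<omega>. Y k \<omega> - 1)"
      using mean[OF that] Yi by (simp add: prob_space)
    ultimately have "0 \<le> expectation (\<lambda>\<omega>. (m k \<omega> * X k \<omega>) * (Y k \<omega> - 1))"
      by simp
    then show ?thesis
      by (simp add: X_def algebra_simps)
  qed
  have drift_int: "integrable M (\<lambda>\<omega>. m k \<omega> * (X (Suc k) \<omega> - X k \<omega>))" if "k < n" for k
    using mX[of "Suc k" k] mX[of k k] that by (auto simp: right_diff_distrib)
  have m_sq: "integrable M (\<lambda>\<omega>. (m n \<omega>)\<^sup>2)"
  proof (rule Bochner_Integration.integrable_bound)
    show "integrable M (\<lambda>\<omega>. \<Sum>i\<le>n. m n \<omega> * X i \<omega>)"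
      by (intro Bochner_Integration.integrable_sum mX) auto
    show "(\<lambda>\<omega>. (m n \<omega>)\<^sup>2) \<in> borel_measurable M"
      by (intro borel_measurable_power m_meas) auto
    have "(m n \<omega>)\<^sup>2 \<le> (\<Sum>i\<le>n. m n \<omega> * X i \<omega>)" for \<omega>
      using mult_left_mono[OF m_le[of n \<omega>] m_nonneg[of n \<omega>]]
      by (simp add: sum_distrib_left power2_eq_square)
    then show "AE \<omega> in M. norm ((m n \<omega>)\<^sup>2) \<le> norm (\<Sum>i\<le>n. m n \<omega> * X i \<omega>)"
      by (simp add: X_nonneg m_nonneg sum_nonneg)
  qed
  \<comment> \<open>Young's inequality removes the mixed term, which leaves a pathwise form of Doob's inequality.\<close>
  have path: "(m n \<omega>)\<^sup>2 / 4 + (\<Sum>k<n. m k \<omega> * (X (Suc k) \<omega> - X k \<omega>)) \<le> (X n \<omega>)\<^sup>2" for \<omega>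
  proof -
    have "0 \<le> (m n \<omega> / 2 - X n \<omega>)\<^sup>2" by simp
    then have "m n \<omega> * X n \<omega> \<le> (m n \<omega>)\<^sup>2 / 4 + (X n \<omega>)\<^sup>2"
      by (simp add: power2_eq_square algebra_simps)
    moreover have "(m n \<omega>)\<^sup>2 / 2 + (\<Sum>k<n. m k \<omega> * (X (Suc k) \<omega> - X k \<omega>)) \<le> m n \<omega> * X n \<omega>"
      unfolding m_def by (rule running_max_summation_by_parts)
    ultimately show ?thesis by linarith
  qed
  have "expectation (\<lambda>\<omega>. (m n \<omega>)\<^sup>2) / 4
      \<le> expectation (\<lambda>\<omega>. (m n \<omega>)\<^sup>2 / 4 + (\<Sum>k<n. m k \<omega> * (X (Suc k) \<omega> - X k \<omega>)))"
  proof -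
    have "0 \<le> (\<Sum>k<n. expectation (\<lambda>\<omega>. m k \<omega> * (X (Suc k) \<omega> - X k \<omega>)))"
      using drift by (intro sum_nonneg) auto
    also have "\<dots> = expectation (\<lambda>\<omega>. \<Sum>k<n. m k \<omega> * (X (Suc k) \<omega> - X k \<omega>))"
      using drift_int by (intro Bochner_Integration.integral_sum[symmetric]) auto
    finally show ?thesis
      using m_sq drift_int
      by (subst Bochner_Integration.integral_add) (auto intro!: Bochner_Integration.integrable_sum)
  qed
  also have "\<dots> \<le> expectation (\<lambda>\<omega>. (X n \<omega>)\<^sup>2)"
    using m_sq drift_int path X_sq
    by (intro integral_mono Bochner_Integration.integrable_add Bochner_Integration.integrable_sum) auto
  finally have "expectation (\<lambda>\<omega>. (m n \<omega>)\<^sup>2) \<le> 4 * (\<Prod>i<n. expectation (\<lambda>\<omega>. (Y i \<omega>)\<^sup>2))"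
    using X_sq(2)[of n] by simp
  then show "integrable M (\<lambda>\<omega>. (Max ((\<lambda>k. \<Prod>i<k. Y i \<omega>) ` {..n}))\<^sup>2)"
    and "expectation (\<lambda>\<omega>. (Max ((\<lambda>k. \<Prod>i<k. Y i \<omega>) ` {..n}))\<^sup>2)
           \<le> 4 * (\<Prod>i<n. expectation (\<lambda>\<omega>. (Y i \<omega>)\<^sup>2))"
    using m_sq by (auto simp: m_def X_def)
qed

section \<open>Maxima of continuous paths\<close>

text \<open>Reduces statements on the maximum of a continuous path (measurability, integrals) to finitely
  many times.\<close>

lemma grid_Max_tendsto_SUP:
  fixes f :: "real \<Rightarrow> real"
  assumes T: "0 \<le> T" and cont: "continuous_on {0..T} f"
  shows "(\<lambda>n. Max ((\<lambda>k. f (T * real k / real n)) ` {..n})) \<longlonglongrightarrow> (SUP t\<in>{0..T}. f t)"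
proof -
  obtain t0 where t0: "t0 \<in> {0..T}" and max: "\<And>t. t \<in> {0..T} \<Longrightarrow> f t \<le> f t0"
    using continuous_attains_sup[OF compact_Icc _ cont] T by auto
  have sup: "(SUP t\<in>{0..T}. f t) = f t0"
    using t0 max by (intro cSup_eq_maximum) auto
  have grid: "T * real k / real n \<in> {0..T}" if "k \<le> n" for k n
    using T that by (cases "n = 0") (auto simp: divide_simps mult_left_mono)
  \<comment> \<open>The grid point just to the left of the maximiser.  For \<open>T = 0\<close> the division by zero makes it the
    point \<open>0\<close>, which is then the only one.\<close>
  define k where "k n = nat \<lfloor>real n * (t0 / T)\<rfloor>" for n
  have frac: "0 \<le> t0 / T" "t0 / T \<le> 1" "T * (t0 / T) = t0"
    using t0 by (auto simp: divide_simps)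
  have k1: "real (k n) \<le> real n * (t0 / T)" and k2: "real n * (t0 / T) < real (k n) + 1" for n
    using frac(1) unfolding k_def
    by (auto simp del: times_divide_eq_right)
  have kn: "k n \<le> n" for n
    using k1[of n] mult_left_mono[OF frac(2), of "real n"] by simp
  have near: "(\<lambda>n. T * real (k n) / real n) \<longlonglongrightarrow> t0"
  proof (rule LIMSEQ_I)
    fix e :: real assume "e > 0"
    obtain N :: nat where N: "real N > T / e" using reals_Archimedean2 by blast
    have "\<bar>T * real (k n) / real n - t0\<bar> < e" if "n \<ge> Suc N" for n
    proof -
      have n: "real n > 0" "T < e * real n"
        using that N \<open>e > 0\<close> by (auto simp: field_simps intro: less_le_trans)
      have "T * real (k n) - t0 * real n = T * (real (k n) - real n * (t0 / T))"
        using frac(3) by (metis (no_types, opaque_lifting) mult.assoc mult.commute right_diff_distrib)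
      then have "\<bar>T * real (k n) - t0 * real n\<bar> = T * \<bar>real (k n) - real n * (t0 / T)\<bar>"
        using T by (simp only: abs_mult abs_of_nonneg)
      also have "\<dots> \<le> T * 1"
        using k1[of n] k2[of n] T by (intro mult_left_mono) auto
      finally have "\<bar>T * real (k n) - t0 * real n\<bar> < e * real n"
        using n by linarith
      moreover have "T * real (k n) / real n - t0 = (T * real (k n) - t0 * real n) / real n"
        using n by (simp add: field_simps)
      ultimately show ?thesis
        using n by (simp add: abs_divide pos_divide_less_eq)
    qed
    then show "\<exists>no. \<forall>n\<ge>no. norm (T * real (k n) / real n - t0) < e"
      by (auto simp del: of_nat_Suc)
  qed
  have lim: "(\<lambda>n. f (T * real (k n) / real n)) \<longlonglongrightarrow> f t0"
    by (rule continuous_on_tendsto_compose[OF cont near t0]) (use grid kn in auto)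
  show ?thesis
    unfolding sup
  proof (rule tendsto_sandwich[OF _ _ lim tendsto_const])
    show "\<forall>\<^sub>F n in sequentially. f (T * real (k n) / real n)
        \<le> Max ((\<lambda>k. f (T * real k / real n)) ` {..n})"
      using kn by (intro always_eventually allI Max_ge) auto
    show "\<forall>\<^sub>F n in sequentially. Max ((\<lambda>k. f (T * real k / real n)) ` {..n}) \<le> f t0"
      using max grid by (intro always_eventually allI Max.boundedI) auto
  qed
qed

lemma borel_measurable_SUP_continuous_paths:
  fixes f :: "real \<Rightarrow> 'w \<Rightarrow> real"
  assumes "0 \<le> T" and meas: "\<And>t. t \<in> {0..T} \<Longrightarrow> f t \<in> borel_measurable M"
    and "\<And>\<omega>. \<omega> \<in> space M \<Longrightarrow> continuous_on {0..T} (\<lambda>t. f t \<omega>)"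
  shows "(\<lambda>\<omega>. SUP t\<in>{0..T}. f t \<omega>) \<in> borel_measurable M"
proof (rule borel_measurable_LIMSEQ_metric)
  show "(\<lambda>\<omega>. Max ((\<lambda>k. f (T * real k / real n) \<omega>) ` {..n})) \<in> borel_measurable M" for n
    using assms(1)
    by (intro borel_measurable_Max meas) (auto simp: divide_simps mult_left_mono)
  show "(\<lambda>n. Max ((\<lambda>k. f (T * real k / real n) \<omega>) ` {..n})) \<longlonglongrightarrow> (SUP t\<in>{0..T}. f t \<omega>)"
    if "\<omega> \<in> space M" for \<omega>
    by (rule grid_Max_tendsto_SUP[OF assms(1) assms(3)[OF that]])
qed

section \<open>Exponential moments of the maximum of the Wiener process\<close>

lemma normal_density_exp_tilt:
  assumes "s > 0"
  shows "normal_density 0 s y * exp (c * y) = exp (s\<^sup>2 * c\<^sup>2 / 2) * normal_density 0 s (y - s\<^sup>2 * c)"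
proof -
  have "- y\<^sup>2 / (2 * s\<^sup>2) + c * y = s\<^sup>2 * c\<^sup>2 / 2 + - (y - s\<^sup>2 * c)\<^sup>2 / (2 * s\<^sup>2)"
    using assms by (simp add: field_simps power2_eq_square)
  then have "exp (- y\<^sup>2 / (2 * s\<^sup>2)) * exp (c * y)
      = exp (s\<^sup>2 * c\<^sup>2 / 2) * exp (- (y - s\<^sup>2 * c)\<^sup>2 / (2 * s\<^sup>2))"
    by (simp only: exp_add[symmetric])
  then show ?thesis by (simp add: normal_density_def)
qed

text \<open>Translation invariance of Lebesgue measure replaces the computation of marginals: multiplying
  the density by the exponential shifts it by \<open>s\<^sup>2 \<theta>\<close>, and the shifted density has the same total mass
  as the original one, which is \<open>1\<close> because it is the density of \<open>X\<close>.\<close>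

lemma gaussian_exp_moment:
  fixes X :: "'w \<Rightarrow> real ^ 'n" and \<theta> :: "real ^ 'n"
  assumes "prob_space M" and s: "s > 0"
    and X: "distributed M lborel X (\<lambda>x. ennreal (\<Prod>i\<in>UNIV. normal_density 0 s (x $ i)))"
  shows "integrable M (\<lambda>\<omega>. exp (\<theta> \<bullet> X \<omega>))"
    and "(\<integral>\<omega>. exp (\<theta> \<bullet> X \<omega>) \<partial>M) = exp (s\<^sup>2 * (norm \<theta>)\<^sup>2 / 2)"
proof -
  interpret prob_space M by fact
  define f where "f x = ennreal (\<Prod>i\<in>UNIV. normal_density 0 s (x $ i))" for x :: "real ^ 'n"
  define c where "c = exp (s\<^sup>2 * (norm \<theta>)\<^sup>2 / 2)"
  have Xm: "X \<in> borel_measurable M" and fm: "f \<in> borel_measurable borel"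
    using X by (auto simp: distributed_def f_def[symmetric])
  \<comment> \<open>Completing the square: the tilted density is a translated one, up to the moment itself.\<close>
  have tilt: "f x * ennreal (exp (\<theta> \<bullet> x)) = ennreal c * f (- (s\<^sup>2 *\<^sub>R \<theta>) + x)" for x
  proof -
    have "(\<Prod>i\<in>UNIV. normal_density 0 s (x $ i)) * exp (\<theta> \<bullet> x)
        = (\<Prod>i\<in>UNIV. normal_density 0 s (x $ i) * exp (\<theta> $ i * x $ i))"
      by (simp add: inner_vec_def exp_sum prod.distrib)
    also have "\<dots> = (\<Prod>i\<in>UNIV. exp (s\<^sup>2 * (\<theta> $ i)\<^sup>2 / 2) * normal_density 0 s (x $ i - s\<^sup>2 * \<theta> $ i))"
      by (simp only: normal_density_exp_tilt[OF s])
    also have "\<dots> = c * (\<Prod>i\<in>UNIV. normal_density 0 s ((- (s\<^sup>2 *\<^sub>R \<theta>) + x) $ i))"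
      by (simp add: prod.distrib c_def norm_vec_def L2_set_def sum_nonneg
          exp_sum[symmetric] sum_distrib_left sum_divide_distrib)
    finally show ?thesis
      by (simp add: f_def ennreal_mult[symmetric] prod_nonneg c_def)
  qed
  have "(\<integral>\<^sup>+\<omega>. ennreal (exp (\<theta> \<bullet> X \<omega>)) \<partial>M) = (\<integral>\<^sup>+x. f x * ennreal (exp (\<theta> \<bullet> x)) \<partial>lborel)"
    by (rule distributed_nn_integral[OF X[folded f_def], symmetric]) measurable
  also have "\<dots> = ennreal c * (\<integral>\<^sup>+x. f (- (s\<^sup>2 *\<^sub>R \<theta>) + x) \<partial>lborel)"
    unfolding tilt using fm by (intro nn_integral_cmult) simp
  also have "(\<integral>\<^sup>+x. f (- (s\<^sup>2 *\<^sub>R \<theta>) + x) \<partial>lborel)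
      = (\<integral>\<^sup>+x. f x \<partial>distr lborel borel ((+) (- (s\<^sup>2 *\<^sub>R \<theta>))))"
    using fm by (subst nn_integral_distr) auto
  also have "\<dots> = (\<integral>\<^sup>+x. f x * 1 \<partial>lborel)"
    by (simp only: lborel_distr_plus mult_1_right)
  also have "\<dots> = (\<integral>\<^sup>+\<omega>. 1 \<partial>M)"
    by (rule distributed_nn_integral[OF X[folded f_def]]) simp
  finally have eq: "(\<integral>\<^sup>+\<omega>. ennreal (exp (\<theta> \<bullet> X \<omega>)) \<partial>M) = ennreal c"
    by (simp add: emeasure_space_1)
  have m: "(\<lambda>\<omega>. exp (\<theta> \<bullet> X \<omega>)) \<in> borel_measurable M"
    using Xm by measurable
  show "integrable M (\<lambda>\<omega>. exp (\<theta> \<bullet> X \<omega>))"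
    by (rule integrableI_nn_integral_finite[OF m _ eq]) simp
  show "(\<integral>\<omega>. exp (\<theta> \<bullet> X \<omega>) \<partial>M) = exp (s\<^sup>2 * (norm \<theta>)\<^sup>2 / 2)"
    using eq by (subst integral_eq_nn_integral[OF m]) (auto simp: c_def)
qed

text \<open>On an equidistant grid the exponential of a linear functional of the process is a partial product
  of independent factors, one for each increment.\<close>

lemma wiener_grid_Doob:
  fixes w :: "real \<Rightarrow> 'w \<Rightarrow> real ^ 'n" and \<theta> :: "real ^ 'n" and S :: real and n :: nat
  assumes W: "standard_wiener_process M w" and S: "0 < S" and n: "0 < n"
  defines "m \<equiv> \<lambda>\<omega>. Max ((\<lambda>k. exp (\<theta> \<bullet> w (S * real k / real n) \<omega>)) ` {..n})"
  shows "(\<integral>\<^sup>+\<omega>. ennreal ((m \<omega>)\<^sup>2) \<partial>M) \<le> ennreal (4 * exp (2 * (norm \<theta>)\<^sup>2 * S))"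
    and "m \<in> borel_measurable M"
proof -
  interpret prob_space M using W by (simp add: standard_wiener_process_def)
  define \<tau> where "\<tau> k = S * real k / real n" for k
  define \<xi> where "\<xi> i \<omega> = w (\<tau> (Suc i)) \<omega> - w (\<tau> i) \<omega>" for i \<omega>
  define Y where "Y i \<omega> = exp (\<theta> \<bullet> \<xi> i \<omega>)" for i \<omega>
  have \<tau>_nonneg: "0 \<le> \<tau> k" for k using S by (simp add: \<tau>_def)
  have gap: "\<tau> (Suc i) - \<tau> i = S / real n" for i
    by (simp add: \<tau>_def diff_divide_distrib[symmetric] algebra_simps)
  have gap_pos: "\<tau> i < \<tau> (Suc i)" for i
    using gap[of i] S n by (smt (verit) divide_pos_pos of_nat_0_less_iff)
  have "mono \<tau>" by (rule incseq_SucI) (simp add: gap_pos less_imp_le)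
  then have "indep_vars (\<lambda>_. borel) \<xi> {..<n}"
    using W \<tau>_nonneg[of 0] mono_on_subset[of UNIV \<tau> "{..n}"]
    unfolding standard_wiener_process_def \<xi>_def by blast
  then have ind: "indep_vars (\<lambda>_. borel) Y {..<n}"
    unfolding Y_def by (rule indep_vars_compose2) auto
  have dist: "distributed M lborel (\<xi> i)
      (\<lambda>x. ennreal (\<Prod>j\<in>UNIV. normal_density 0 (sqrt (S / n)) (x $ j)))" for i
    using W \<tau>_nonneg[of i] gap_pos[of i]
    unfolding standard_wiener_process_def \<xi>_def gap[of i, symmetric] by blast
  have sd: "sqrt (S / n) > 0" "(sqrt (S / n))\<^sup>2 = S / n" using S n by auto
  note moment = gaussian_exp_moment[OF prob_space_axioms sd(1) dist, unfolded sd(2)]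
  have Y_sq: "(Y i \<omega>)\<^sup>2 = exp ((2 *\<^sub>R \<theta>) \<bullet> \<xi> i \<omega>)" for i \<omega>
    by (simp add: Y_def exp_double[symmetric])
  have E_Y: "1 \<le> expectation (Y i)" for i
    unfolding Y_def moment(2) using S by simp
  have E_Y_sq: "expectation (\<lambda>\<omega>. (Y i \<omega>)\<^sup>2) = exp (2 * (norm \<theta>)\<^sup>2 * (S / n))" for i
    unfolding Y_sq moment(2) by (simp add: power_mult_distrib algebra_simps)
  have X: "(\<Prod>i<k. Y i \<omega>) = exp (\<theta> \<bullet> w (\<tau> k) \<omega>)" if "\<omega> \<in> space M" for k \<omega>
  proof -
    have "(\<Sum>i<k. \<xi> i \<omega>) = w (\<tau> k) \<omega>"
      unfolding \<xi>_def using W that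
      by (subst sum_lessThan_telescope) (simp add: \<tau>_def standard_wiener_process_def)
    then show ?thesis by (simp add: Y_def exp_sum[symmetric] inner_sum_right[symmetric])
  qed
  have m: "m \<omega> = Max ((\<lambda>k. \<Prod>i<k. Y i \<omega>) ` {..n})" if "\<omega> \<in> space M" for \<omega>
    unfolding m_def \<tau>_def[symmetric] by (simp add: X[OF that])
  note Doob = Doob_L2_product[OF ind, unfolded E_Y_sq]
  have sq: "integrable M (\<lambda>\<omega>. (Y i \<omega>)\<^sup>2)" for i
    unfolding Y_sq by (rule moment(1))
  have Y_nonneg: "0 \<le> Y i \<omega>" for i \<omega> by (simp add: Y_def)
  have int: "integrable M (\<lambda>\<omega>. (m \<omega>)\<^sup>2)"
    using Doob(1)[OF sq E_Y Y_nonneg] m by (simp cong: Bochner_Integration.integrable_cong)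
  have "(\<integral>\<^sup>+\<omega>. ennreal ((m \<omega>)\<^sup>2) \<partial>M) = ennreal (expectation (\<lambda>\<omega>. (m \<omega>)\<^sup>2))"
    by (rule nn_integral_eq_integral[OF int]) simp
  also have "expectation (\<lambda>\<omega>. (m \<omega>)\<^sup>2) = expectation (\<lambda>\<omega>. (Max ((\<lambda>k. \<Prod>i<k. Y i \<omega>) ` {..n}))\<^sup>2)"
    by (rule Bochner_Integration.integral_cong) (auto simp: m)
  also have "\<dots> \<le> 4 * (\<Prod>i<n. exp (2 * (norm \<theta>)\<^sup>2 * (S / n)))"
    by (rule Doob(2)[OF sq E_Y Y_nonneg])
  also have "\<dots> = 4 * exp (2 * (norm \<theta>)\<^sup>2 * S)"
    using n by (simp add: exp_of_nat_mult[symmetric])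
  finally show "(\<integral>\<^sup>+\<omega>. ennreal ((m \<omega>)\<^sup>2) \<partial>M) \<le> ennreal (4 * exp (2 * (norm \<theta>)\<^sup>2 * S))"
    by (simp add: ennreal_leI)
  have "w (\<tau> k) \<in> borel_measurable M" for k
    using W \<tau>_nonneg by (auto simp: standard_wiener_process_def)
  then show "m \<in> borel_measurable M"
    unfolding m_def \<tau>_def[symmetric] by measurable
qed

text \<open>Replaces the norm, whose exponential is not a product over the increments of the process, by linear
  functionals: the norm is at most the dimension times the modulus of some coordinate.\<close>

lemma exp_norm_le_sum_axes:
  fixes x :: "real ^ 'n" and c :: real
  assumes "0 \<le> c"
  shows "exp (c * norm x)
      \<le> (\<Sum>i\<in>UNIV. exp (c * CARD('n) * x $ i) + exp (- (c * CARD('n) * x $ i)))"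
proof -
  have "\<exists>i. norm x \<le> CARD('n) * \<bar>x $ i\<bar>"
  proof (rule ccontr)
    assume "\<not> ?thesis"
    then have "(\<Sum>i\<in>(UNIV :: 'n set). \<bar>x $ i\<bar>) < (\<Sum>i\<in>(UNIV :: 'n set). norm x / CARD('n))"
      by (intro sum_strict_mono) (auto simp: not_le field_simps)
    with norm_le_l1_cart[of x] show False by simp
  qed
  then obtain i where i: "norm x \<le> CARD('n) * \<bar>x $ i\<bar>" ..
  have "exp (c * norm x) \<le> exp \<bar>c * CARD('n) * x $ i\<bar>"
    using mult_left_mono[OF i assms] assms by (simp add: abs_mult mult.assoc)
  also have "\<dots> \<le> exp (c * CARD('n) * x $ i) + exp (- (c * CARD('n) * x $ i))"
    by (cases "0 \<le> c * CARD('n) * x $ i") (auto simp: abs_if add_increasing add_increasing2)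
  also have "\<dots> \<le> (\<Sum>i\<in>UNIV. exp (c * CARD('n) * x $ i) + exp (- (c * CARD('n) * x $ i)))"
    by (rule member_le_sum) (auto intro: add_nonneg_nonneg)
  finally show ?thesis .
qed

text \<open>Each of the \<open>2 CARD('n)\<close> coordinate functionals \<open>\<plusminus> w $ i\<close> contributes one maximal inequality, with the
  constant \<open>4\<close> and the Gaussian moment at the final time.  That the exponent is quadratic in \<open>c\<close> and
  linear in \<open>S\<close> decides the exponent of the final estimate.\<close>

lemma wiener_exp_sup_moment:
  fixes w :: "real \<Rightarrow> 'w \<Rightarrow> real ^ 'n" and S c :: real
  assumes W: "standard_wiener_process M w" and S: "0 < S" and c: "0 \<le> c"
  shows "(\<integral>\<^sup>+\<omega>. ennreal (exp (c * (SUP s\<in>{0..S}. norm (w s \<omega>)))) \<partial>M)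
      \<le> ennreal (8 * CARD('n) * exp ((c * CARD('n))\<^sup>2 * S / 2))"
proof -
  define N where "N = real CARD('n)"
  define C where "C = exp ((c * N)\<^sup>2 * S / 2)"
  define m where "m \<theta> n \<omega> = Max ((\<lambda>k. exp (\<theta> \<bullet> w (S * real k / real n) \<omega>)) ` {..n})" for \<theta> and n :: nat and \<omega>
  \<comment> \<open>Half of the exponent is put into the test vector, because the maximal inequality bounds the
    square of the maximum.\<close>
  define e where "e i = axis i (c * N / 2)" for i :: 'n
  define g where "g n \<omega> = exp (c * Max ((\<lambda>k. norm (w (S * real k / real n) \<omega>)) ` {..n}))" for n \<omega>
  have m_bound: "(\<integral>\<^sup>+\<omega>. ennreal ((m \<theta> n \<omega>)\<^sup>2) \<partial>M) \<le> ennreal (4 * C)"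
    if "norm \<theta> = norm (e i)" "0 < n" for \<theta> i and n :: nat
  proof -
    have "(norm \<theta>)\<^sup>2 = (c * N / 2)\<^sup>2"
      unfolding that(1) power2_norm_eq_inner e_def by (simp add: inner_axis_axis power2_eq_square)
    then have "2 * (norm \<theta>)\<^sup>2 * S = (c * N)\<^sup>2 * S / 2"
      by (simp add: power2_eq_square)
    then show ?thesis
      using wiener_grid_Doob(1)[OF W S that(2), of \<theta>] unfolding m_def C_def by metis
  qed
  have m_meas: "m \<theta> n \<in> borel_measurable M" if "0 < n" for \<theta> n
  proof -
    have "m \<theta> n = (\<lambda>\<omega>. Max ((\<lambda>k. exp (\<theta> \<bullet> w (S * real k / real n) \<omega>)) ` {..n}))"
      by (simp add: m_def fun_eq_iff)
    with wiener_grid_Doob(2)[OF W S that, where \<theta> = \<theta>] show ?thesis by simp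
  qed
  have m_ge: "exp (2 * (\<theta> \<bullet> w (S * real k / real n) \<omega>)) \<le> (m \<theta> n \<omega>)\<^sup>2" if "k \<le> n" for \<theta> k n \<omega>
  proof -
    have "exp (\<theta> \<bullet> w (S * real k / real n) \<omega>) \<le> m \<theta> n \<omega>"
      unfolding m_def using that by (intro Max_ge) auto
    then show ?thesis by (simp add: exp_double power_mono)
  qed
  have g_le: "g n \<omega> \<le> (\<Sum>i\<in>UNIV. (m (e i) n \<omega>)\<^sup>2 + (m (- e i) n \<omega>)\<^sup>2)" for n \<omega>
  proof -
    have "Max ((\<lambda>k. norm (w (S * real k / real n) \<omega>)) ` {..n})
        \<in> (\<lambda>k. norm (w (S * real k / real n) \<omega>)) ` {..n}"
      by (rule Max_in) auto
    then obtain k where k: "k \<le> n" and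
      max: "Max ((\<lambda>k. norm (w (S * real k / real n) \<omega>)) ` {..n}) = norm (w (S * real k / real n) \<omega>)"
      by blast
    have "g n \<omega> \<le> (\<Sum>i\<in>UNIV. exp (2 * (e i \<bullet> w (S * real k / real n) \<omega>))
                           + exp (2 * (- e i \<bullet> w (S * real k / real n) \<omega>)))"
      unfolding g_def max using exp_norm_le_sum_axes[OF c, of "w (S * real k / real n) \<omega>"]
      by (simp add: e_def N_def inner_axis')
    also have "\<dots> \<le> (\<Sum>i\<in>UNIV. (m (e i) n \<omega>)\<^sup>2 + (m (- e i) n \<omega>)\<^sup>2)"
      by (intro sum_mono add_mono m_ge k)
    finally show ?thesis .
  qed
  have bound: "(\<integral>\<^sup>+\<omega>. ennreal (g n \<omega>) \<partial>M) \<le> ennreal (8 * N * C)" if n: "0 < n" for n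
  proof -
    note [measurable] = m_meas[OF n]
    have "(\<integral>\<^sup>+\<omega>. ennreal (g n \<omega>) \<partial>M)
        \<le> (\<integral>\<^sup>+\<omega>. (\<Sum>i\<in>UNIV. ennreal ((m (e i) n \<omega>)\<^sup>2) + ennreal ((m (- e i) n \<omega>)\<^sup>2)) \<partial>M)"
    proof (rule nn_integral_mono)
      fix \<omega>
      have "ennreal (g n \<omega>) \<le> ennreal (\<Sum>i\<in>UNIV. (m (e i) n \<omega>)\<^sup>2 + (m (- e i) n \<omega>)\<^sup>2)"
        by (rule ennreal_leI[OF g_le])
      also have "\<dots> = (\<Sum>i\<in>UNIV. ennreal ((m (e i) n \<omega>)\<^sup>2) + ennreal ((m (- e i) n \<omega>)\<^sup>2))"
        by (subst sum_ennreal[symmetric]) (auto intro!: sum.cong)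
      finally show "ennreal (g n \<omega>)
          \<le> (\<Sum>i\<in>UNIV. ennreal ((m (e i) n \<omega>)\<^sup>2) + ennreal ((m (- e i) n \<omega>)\<^sup>2))" .
    qed
    also have "\<dots> = (\<Sum>i\<in>UNIV. (\<integral>\<^sup>+\<omega>. ennreal ((m (e i) n \<omega>)\<^sup>2) \<partial>M)
        + (\<integral>\<^sup>+\<omega>. ennreal ((m (- e i) n \<omega>)\<^sup>2) \<partial>M))"
      by (simp add: nn_integral_sum nn_integral_add)
    also have "\<dots> \<le> (\<Sum>i\<in>(UNIV :: 'n set). ennreal (4 * C) + ennreal (4 * C))"
      by (intro sum_mono add_mono m_bound n) auto
    also have "\<dots> = ennreal (8 * N * C)"
      by (simp add: N_def C_def ennreal_plus[symmetric] ennreal_mult[symmetric]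
          ennreal_of_nat_eq_real_of_nat algebra_simps del: ennreal_plus)
    finally show ?thesis .
  qed
  have lim: "(\<lambda>n. g n \<omega>) \<longlonglongrightarrow> exp (c * (SUP s\<in>{0..S}. norm (w s \<omega>)))" if "\<omega> \<in> space M" for \<omega>
  proof -
    have "continuous_on {0..S} (\<lambda>s. w s \<omega>)"
      using W that by (auto simp: standard_wiener_process_def intro: continuous_on_subset)
    then show ?thesis
      unfolding g_def using S by (intro tendsto_intros grid_Max_tendsto_SUP continuous_intros) auto
  qed
  have "w (S * real k / real n) \<in> borel_measurable M" for k n
    using W S by (auto simp: standard_wiener_process_def)
  then have g_meas: "g n \<in> borel_measurable M" for n
    unfolding g_def by measurable
  \<comment> \<open>Fatou's lemma along the grids.\<close>
  have "(\<integral>\<^sup>+\<omega>. ennreal (exp (c * (SUP s\<in>{0..S}. norm (w s \<omega>)))) \<partial>M)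
      = (\<integral>\<^sup>+\<omega>. liminf (\<lambda>n. ennreal (g n \<omega>)) \<partial>M)"
    using lim by (intro nn_integral_cong lim_imp_Liminf[symmetric] tendsto_ennrealI) auto
  also have "\<dots> \<le> liminf (\<lambda>n. \<integral>\<^sup>+\<omega>. ennreal (g n \<omega>) \<partial>M)"
    using g_meas by (intro nn_integral_liminf) auto
  also have "\<dots> \<le> liminf (\<lambda>n. ennreal (8 * N * C))"
    by (intro Liminf_mono eventually_sequentiallyI[of 1] bound) auto
  also have "\<dots> = ennreal (8 * N * C)"
    by (simp add: Liminf_const)
  finally show ?thesis by (simp add: N_def C_def)
qed

section \<open>Mollified paths and their velocities\<close>

text \<open>The kernel at time \<open>t\<close> lives on \<open>{t..t + \<delta>}\<close>, so the half-line may be replaced by any larger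
  interval.  The freedom is used in two ways: the exact support for estimates, and an interval that
  does not depend on \<open>t\<close> for differentiation.\<close>

lemma mollify_eq_integral:
  fixes f :: "real \<Rightarrow> 'a::euclidean_space"
  assumes cont: "continuous_on UNIV \<rho>" and supp: "\<And>x. x \<notin> {0..1} \<Longrightarrow> \<rho> x = 0"
    and \<delta>: "0 < \<delta>" and f: "continuous_on {0..} f" and a: "0 \<le> a" "a \<le> t" and R: "t + \<delta> \<le> R"
  shows "mollify \<rho> \<delta> f t = (1 / \<delta>) *\<^sub>R integral {a..R} (\<lambda>s. \<rho> ((s - t) / \<delta>) *\<^sub>R f s)"
proof -
  have out: "\<rho> ((s - t) / \<delta>) = 0" if "s \<notin> {a..R}" for s
    using that a R \<delta> by (intro supp) (auto simp: divide_simps)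
  have "continuous_on {a..R} (\<lambda>s. \<rho> ((s - t) / \<delta>) *\<^sub>R f s)"
    using a \<delta> by (intro continuous_intros continuous_on_compose2[OF cont] continuous_on_subset[OF f]) auto
  then have "(LINT s:{a..R}|lborel. \<rho> ((s - t) / \<delta>) *\<^sub>R f s)
      = integral {a..R} (\<lambda>s. \<rho> ((s - t) / \<delta>) *\<^sub>R f s)"
    by (intro set_borel_integral_eq_integral borel_integrable_atLeastAtMost')
  moreover have "(LINT s:{0..}|lborel. \<rho> ((s - t) / \<delta>) *\<^sub>R f s)
      = (LINT s:{a..R}|lborel. \<rho> ((s - t) / \<delta>) *\<^sub>R f s)"
    unfolding set_lebesgue_integral_def
    using out a by (intro Bochner_Integration.integral_cong) (auto simp: indicator_def)
  ultimately show ?thesis by (simp add: mollify_def)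
qed

text \<open>The prefactor \<open>1 / \<delta>\<close> is compensated by the length of the support of the kernel.\<close>

lemma norm_mollify_le:
  fixes f :: "real \<Rightarrow> 'a::euclidean_space"
  assumes cont: "continuous_on UNIV \<rho>" and supp: "\<And>x. x \<notin> {0..1} \<Longrightarrow> \<rho> x = 0"
    and \<delta>: "0 < \<delta>" and f: "continuous_on {0..} f" and t: "0 \<le> t"
    and K: "\<And>x. \<bar>\<rho> x\<bar> \<le> K" and X: "\<And>s. s \<in> {t..t + \<delta>} \<Longrightarrow> norm (f s) \<le> X"
  shows "norm (mollify \<rho> \<delta> f t) \<le> K * X"
proof -
  have "0 \<le> K" using K[of 0] by linarith
  have "norm (integral {t..t + \<delta>} (\<lambda>s. \<rho> ((s - t) / \<delta>) *\<^sub>R f s)) \<le> (K * X) * ((t + \<delta>) - t)"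
  proof (rule integral_bound)
    show "continuous_on {t..t + \<delta>} (\<lambda>s. \<rho> ((s - t) / \<delta>) *\<^sub>R f s)"
      using t \<delta> by (intro continuous_intros continuous_on_compose2[OF cont] continuous_on_subset[OF f]) auto
    show "norm (\<rho> ((s - t) / \<delta>) *\<^sub>R f s) \<le> K * X" if "s \<in> {t..t + \<delta>}" for s
      using K X[OF that] \<open>0 \<le> K\<close> by (simp add: mult_mono)
  qed (use \<delta> in auto)
  then show ?thesis
    using \<delta> by (subst mollify_eq_integral[OF cont supp \<delta> f t order_refl order_refl])
      (auto simp: divide_simps mult.commute)
qed

text \<open>Differentiation costs a factor \<open>1 / \<delta>\<close> and otherwise only changes the kernel, so that the velocity
  and the acceleration of a mollified path are again mollifications.\<close>

lemma mollify_has_vector_derivative: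
  fixes f :: "real \<Rightarrow> 'a::euclidean_space"
  assumes deriv: "\<And>x. (\<rho> has_real_derivative \<rho>' x) (at x)"
    and cont: "continuous_on UNIV \<rho>'"
    and supp: "\<And>x. x \<notin> {0..1} \<Longrightarrow> \<rho> x = 0" "\<And>x. x \<notin> {0..1} \<Longrightarrow> \<rho>' x = 0"
    and \<delta>: "0 < \<delta>" and f: "continuous_on {0..} f" and t: "0 \<le> t"
  shows "(mollify \<rho> \<delta> f has_vector_derivative - (1 / \<delta>) *\<^sub>R mollify \<rho>' \<delta> f t) (at t within {0..})"
proof -
  have cont0: "continuous_on UNIV \<rho>"
    using deriv by (intro continuous_at_imp_continuous_on) (auto intro: DERIV_isCont)
  \<comment> \<open>Fixed limits of integration that serve for all parameters in \<open>{0..t + 1}\<close>, so that only the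
    kernel depends on the parameter.\<close>
  define R where "R = t + 1 + \<delta>"
  define g where "g r s = \<rho> ((s - r) / \<delta>) *\<^sub>R f s" for r s
  define g' where "g' r s = (- (1 / \<delta>) * \<rho>' ((s - r) / \<delta>)) *\<^sub>R f s" for r s
  have "((\<lambda>r. integral (cbox 0 R) (g r)) has_vector_derivative integral (cbox 0 R) (g' t))
      (at t within {0..t + 1})"
  proof (rule leibniz_rule_vector_derivative)
    show "((\<lambda>r. g r s) has_vector_derivative g' r s) (at r within {0..t + 1})" for r s
    proof -
      have "((\<lambda>r. (s - r) / \<delta>) has_real_derivative - (1 / \<delta>)) (at r within {0..t + 1})"
        using \<delta> by (auto intro!: derivative_eq_intros)
      then have "((\<lambda>r. \<rho> ((s - r) / \<delta>)) has_real_derivative \<rho>' ((s - r) / \<delta>) * (- (1 / \<delta>)))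
          (at r within {0..t + 1})"
        by (rule DERIV_chain2[OF deriv])
      then show ?thesis
        unfolding g_def g'_def by (auto intro!: derivative_eq_intros simp: mult.commute)
    qed
    show "g r integrable_on cbox 0 R" for r
      unfolding g_def
      by (intro integrable_continuous continuous_intros continuous_on_compose2[OF cont0]
          continuous_on_subset[OF f]) (use \<delta> in auto)
    show "continuous_on ({0..t + 1} \<times> cbox 0 R) (\<lambda>(r, s). g' r s)"
      unfolding g'_def case_prod_beta
      by (intro continuous_intros continuous_on_compose2[OF cont] continuous_on_compose2[OF f])
        (use \<delta> in auto)
  qed (use t in auto)
  then have "((\<lambda>r. (1 / \<delta>) *\<^sub>R integral {0..R} (g r)) has_vector_derivative
      (1 / \<delta>) *\<^sub>R integral {0..R} (g' t)) (at t within {0..t + 1})"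
    by (intro derivative_eq_intros) auto
  moreover have "(1 / \<delta>) *\<^sub>R integral {0..R} (g' t) = - (1 / \<delta>) *\<^sub>R mollify \<rho>' \<delta> f t"
  proof -
    have "integral {0..R} (g' t) = - (1 / \<delta>) *\<^sub>R integral {0..R} (\<lambda>s. \<rho>' ((s - t) / \<delta>) *\<^sub>R f s)"
      unfolding g'_def by (simp only: scaleR_scaleR[symmetric] integral_cmul)
    moreover have "mollify \<rho>' \<delta> f t = (1 / \<delta>) *\<^sub>R integral {0..R} (\<lambda>s. \<rho>' ((s - t) / \<delta>) *\<^sub>R f s)"
      by (rule mollify_eq_integral[OF cont supp(2) \<delta> f]) (use t in \<open>auto simp: R_def\<close>)
    ultimately show ?thesis by simp
  qed
  moreover have eq: "mollify \<rho> \<delta> f r = (1 / \<delta>) *\<^sub>R integral {0..R} (g r)" if "r \<in> {0..t + 1}" for r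
    unfolding g_def
    by (rule mollify_eq_integral[OF cont0 supp(1) \<delta> f]) (use that in \<open>auto simp: R_def\<close>)
  ultimately have "(mollify \<rho> \<delta> f has_vector_derivative - (1 / \<delta>) *\<^sub>R mollify \<rho>' \<delta> f t)
      (at t within {0..t + 1})"
    using t by (intro has_vector_derivative_transform[OF _ eq]) auto
  moreover have "at t within {0..t + 1} = at t within {0..}"
    by (rule at_within_nhd[of _ "{..<t + 1}"]) auto
  ultimately show ?thesis by simp
qed

lemma deriv_eq_0_outside_support:
  fixes g :: "real \<Rightarrow> real"
  assumes "\<And>x. x \<notin> {0..1} \<Longrightarrow> g x = 0" "x \<notin> {0..1}"
  shows "deriv g x = 0"
proof -
  have "(g has_field_derivative 0) (at x)"
    by (rule has_field_derivative_transform_within_open[of "\<lambda>_. 0" _ _ "- {0..1}"])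
      (use assms in \<open>auto simp: open_Compl\<close>)
  then show ?thesis by (rule DERIV_imp_deriv)
qed

lemma mollifier_first_two_derivatives:
  assumes "mollifier \<rho>"
  obtains \<rho>' \<rho>'' K where
    "\<And>x. (\<rho> has_real_derivative \<rho>' x) (at x)" "\<And>x. (\<rho>' has_real_derivative \<rho>'' x) (at x)"
    "continuous_on UNIV \<rho>'" "continuous_on UNIV \<rho>''"
    "\<And>x. x \<notin> {0..1} \<Longrightarrow> \<rho> x = 0" "\<And>x. x \<notin> {0..1} \<Longrightarrow> \<rho>' x = 0" "\<And>x. x \<notin> {0..1} \<Longrightarrow> \<rho>'' x = 0"
    "\<And>x. \<bar>\<rho>' x\<bar> \<le> K" "\<And>x. \<bar>\<rho>'' x\<bar> \<le> K"
proof -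
  have diff: "(deriv ^^ n) \<rho> differentiable_on UNIV" for n
    using assms by (simp add: mollifier_def)
  have der: "((deriv ^^ n) \<rho> has_real_derivative (deriv ^^ Suc n) \<rho> x) (at x)" for n x
    using diff[of n] by (simp add: differentiable_on_def DERIV_deriv_iff_real_differentiable)
  have cont: "continuous_on UNIV ((deriv ^^ n) \<rho>)" for n
    using diff by (rule differentiable_imp_continuous_on)
  have supp: "(deriv ^^ n) \<rho> x = 0" if "x \<notin> {0..1}" for n x
    using that
  proof (induction n arbitrary: x)
    case 0
    then show ?case using assms by (simp add: mollifier_def)
  next
    case (Suc n)
    then show ?case using deriv_eq_0_outside_support[of "(deriv ^^ n) \<rho>" x] by simp
  qed
  have bdd: "\<exists>K. \<forall>x. \<bar>(deriv ^^ n) \<rho> x\<bar> \<le> K" for n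
  proof -
    have "compact ((deriv ^^ n) \<rho> ` {0..1})"
      by (intro compact_continuous_image continuous_on_subset[OF cont]) auto
    then obtain B where B: "\<And>x. x \<in> {0..1} \<Longrightarrow> \<bar>(deriv ^^ n) \<rho> x\<bar> \<le> B"
      using compact_imp_bounded bounded_iff by (metis imageI real_norm_def)
    have "\<bar>(deriv ^^ n) \<rho> x\<bar> \<le> max B 0" for x
      using B[of x] supp[of x n] by (cases "x \<in> {0..1}") auto
    then show ?thesis by blast
  qed
  obtain K1 K2 where K: "\<And>x. \<bar>(deriv ^^ 1) \<rho> x\<bar> \<le> K1" "\<And>x. \<bar>(deriv ^^ 2) \<rho> x\<bar> \<le> K2"
    using bdd[of 1] bdd[of 2] by blast
  show ?thesis
    by (rule that[of "(deriv ^^ 1) \<rho>" "(deriv ^^ 2) \<rho>" "max K1 K2"])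
      (use der[of 0] der[of 1] cont[of 1] cont[of 2] supp[of _ 0] supp[of _ 1] supp[of _ 2] K in
        \<open>auto simp: numeral_2_eq_2 intro: le_max_iff_disj[THEN iffD2]\<close>)
qed

lemma mollified_velocity_eq_mollify:
  fixes f :: "real \<Rightarrow> 'a::euclidean_space"
  assumes deriv: "\<And>x. (\<rho> has_real_derivative \<rho>' x) (at x)"
    and cont: "continuous_on UNIV \<rho>'"
    and supp: "\<And>x. x \<notin> {0..1} \<Longrightarrow> \<rho> x = 0" "\<And>x. x \<notin> {0..1} \<Longrightarrow> \<rho>' x = 0"
    and \<delta>: "0 < \<delta>" and f: "continuous_on {0..} f" and t: "0 \<le> t"
  shows "mollified_velocity \<rho> \<delta> f t = - (1 / \<delta>) *\<^sub>R mollify \<rho>' \<delta> f t"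
  unfolding mollified_velocity_def
proof (rule vector_derivative_within)
  show "at t within {0..} \<noteq> bot"
  proof
    assume "at t within {0..} = bot"
    moreover have "at_right t \<le> at t within {0..}" using t by (intro at_le) auto
    ultimately have "at_right t = bot" using le_bot by metis
    then show False using trivial_limit_at_right_real[of t] by contradiction
  qed
qed (rule mollify_has_vector_derivative[OF deriv cont supp \<delta> f t])

text \<open>The only information on the driving signal that the comparison of the two equations needs: its
  size is of order \<open>X / \<delta>\<close> and that of its derivative of order \<open>X / \<delta>\<^sup>2\<close>, where \<open>X\<close> bounds the path on
  the window ahead.\<close>

lemma mollified_velocity_bounds:
  assumes "mollifier \<rho>"
  obtains \<kappa> where "0 \<le> \<kappa>"
    "\<And>(f :: real \<Rightarrow> 'a::euclidean_space) \<delta> t X. continuous_on {0..} f \<Longrightarrow> 0 < \<delta> \<Longrightarrow> 0 \<le> t \<Longrightarrow>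
       (\<And>s. s \<in> {t..t + \<delta>} \<Longrightarrow> norm (f s) \<le> X) \<Longrightarrow>
       norm (mollified_velocity \<rho> \<delta> f t) \<le> \<kappa> * X / \<delta> \<and>
       (\<exists>u'. (mollified_velocity \<rho> \<delta> f has_vector_derivative u') (at t within {0..}) \<and>
             norm u' \<le> \<kappa> * X / \<delta>\<^sup>2)"
proof -
  obtain \<rho>' \<rho>'' K where \<rho>:
    "\<And>x. (\<rho> has_real_derivative \<rho>' x) (at x)" "\<And>x. (\<rho>' has_real_derivative \<rho>'' x) (at x)"
    "continuous_on UNIV \<rho>'" "continuous_on UNIV \<rho>''"
    "\<And>x. x \<notin> {0..1} \<Longrightarrow> \<rho> x = 0" "\<And>x. x \<notin> {0..1} \<Longrightarrow> \<rho>' x = 0" "\<And>x. x \<notin> {0..1} \<Longrightarrow> \<rho>'' x = 0"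
    "\<And>x. \<bar>\<rho>' x\<bar> \<le> K" "\<And>x. \<bar>\<rho>'' x\<bar> \<le> K"
    using mollifier_first_two_derivatives[OF assms] by blast
  show ?thesis
  proof (rule that[of K])
    show "0 \<le> K" using \<rho>(8)[of 0] by linarith
    fix f :: "real \<Rightarrow> 'a" and \<delta> t X :: real
    assume f: "continuous_on {0..} f" and \<delta>: "0 < \<delta>" and t: "0 \<le> t"
      and X: "\<And>s. s \<in> {t..t + \<delta>} \<Longrightarrow> norm (f s) \<le> X"
    have u: "mollified_velocity \<rho> \<delta> f r = - (1 / \<delta>) *\<^sub>R mollify \<rho>' \<delta> f r" if "0 \<le> r" for r
      by (rule mollified_velocity_eq_mollify[OF \<rho>(1,3,5,6) \<delta> f that])
    have "norm (mollify \<rho>' \<delta> f t) \<le> K * X"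
      by (rule norm_mollify_le[OF \<rho>(3,6) \<delta> f t \<rho>(8) X])
    then have 1: "norm (mollified_velocity \<rho> \<delta> f t) \<le> K * X / \<delta>"
      using \<delta> by (simp add: u[OF t] divide_right_mono)
    define u' where "u' = - (1 / \<delta>) *\<^sub>R (- (1 / \<delta>) *\<^sub>R mollify \<rho>'' \<delta> f t)"
    have "((\<lambda>r. - (1 / \<delta>) *\<^sub>R mollify \<rho>' \<delta> f r) has_vector_derivative u') (at t within {0..})"
      unfolding u'_def
      by (intro bounded_linear.has_vector_derivative[OF bounded_linear_scaleR_right]
          mollify_has_vector_derivative[OF \<rho>(2,4,6,7) \<delta> f t])
    then have 2: "(mollified_velocity \<rho> \<delta> f has_vector_derivative u') (at t within {0..})"
      by (rule has_vector_derivative_transform[rotated 2]) (use t u in auto)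
    have "norm (mollify \<rho>'' \<delta> f t) \<le> K * X"
      by (rule norm_mollify_le[OF \<rho>(4,7) \<delta> f t \<rho>(9) X])
    then have "norm u' \<le> K * X / \<delta>\<^sup>2"
      using \<delta> by (simp add: u'_def power2_eq_square divide_right_mono)
    with 1 2 show "norm (mollified_velocity \<rho> \<delta> f t) \<le> K * X / \<delta> \<and>
       (\<exists>u'. (mollified_velocity \<rho> \<delta> f has_vector_derivative u') (at t within {0..}) \<and>
             norm u' \<le> K * X / \<delta>\<^sup>2)" by blast
  qed
qed

text \<open>Joint measurability by approximation with step functions in time.  The process is evaluated at
  \<open>max 0 s\<close>, since nothing is known at negative times.\<close>

lemma borel_measurable_Caratheodory:
  fixes f :: "real \<Rightarrow> 'w \<Rightarrow> 'b::metric_space"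
  assumes meas: "\<And>s. 0 \<le> s \<Longrightarrow> f s \<in> borel_measurable M"
    and cont: "\<And>\<omega>. \<omega> \<in> space M \<Longrightarrow> continuous_on {0..} (\<lambda>s. f s \<omega>)"
  shows "(\<lambda>(\<omega>, s). f (max 0 s) \<omega>) \<in> borel_measurable (M \<Otimes>\<^sub>M lborel)"
proof (rule borel_measurable_LIMSEQ_metric)
  define k where "k n s = nat \<lfloor>real n * s\<rfloor>" for n s
  show "(\<lambda>(\<omega>, s). f (real (k n s) / real n) \<omega>) \<in> borel_measurable (M \<Otimes>\<^sub>M lborel)" for n
  proof -
    have "(\<lambda>z. f (real (k n (snd z)) / real n) (fst z)) \<in> borel_measurable (M \<Otimes>\<^sub>M lborel)"
    proof (rule measurable_compose_countable[where f = "\<lambda>i z. f (real i / real n) (fst z)"])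
      show "(\<lambda>z. f (real i / real n) (fst z)) \<in> borel_measurable (M \<Otimes>\<^sub>M lborel)" for i
        by (rule measurable_compose[OF measurable_fst meas]) simp
      show "(\<lambda>z. k n (snd z)) \<in> measurable (M \<Otimes>\<^sub>M lborel) (count_space UNIV)"
        unfolding k_def by measurable
    qed
    then show ?thesis by (simp add: case_prod_beta)
  qed
  fix z :: "'w \<times> real" assume "z \<in> space (M \<Otimes>\<^sub>M lborel)"
  then obtain \<omega> s where z: "z = (\<omega>, s)" and \<omega>: "\<omega> \<in> space M" by (auto simp: space_pair_measure)
  have "(\<lambda>n. real (k n s) / real n) \<longlonglongrightarrow> max 0 s"
  proof (rule tendsto_sandwich)
    show "\<forall>\<^sub>F n in sequentially. max 0 s - 1 / real n \<le> real (k n s) / real n"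
      unfolding k_def using eventually_gt_at_top[of 0]
    proof eventually_elim
      case (elim n)
      have "real n * max 0 s - 1 \<le> real (nat \<lfloor>real n * s\<rfloor>)"
      proof (cases "0 \<le> s")
        case True
        then have "0 \<le> real n * s" by simp
        then show ?thesis using True by (simp add: max_def)
      qed simp
      then have "(real n * max 0 s - 1) / real n \<le> real (nat \<lfloor>real n * s\<rfloor>) / real n"
        by (rule divide_right_mono) simp
      with elim show ?case by (simp add: diff_divide_distrib)
    qed
    show "\<forall>\<^sub>F n in sequentially. real (k n s) / real n \<le> max 0 s"
      unfolding k_def using eventually_gt_at_top[of 0]
    proof eventually_elim
      case (elim n)
      have "real (nat \<lfloor>real n * s\<rfloor>) \<le> real n * max 0 s"
        using mult_nonneg_nonpos[of "real n" s] by (cases "0 \<le> s") (auto simp: max_def)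
      then have "real (nat \<lfloor>real n * s\<rfloor>) / real n \<le> real n * max 0 s / real n"
        by (rule divide_right_mono) simp
      with elim show ?case by simp
    qed
    have "(\<lambda>n. max 0 s - 1 / real n) \<longlonglongrightarrow> max 0 s - 0"
      by (intro tendsto_intros lim_1_over_n)
    then show "(\<lambda>n. max 0 s - 1 / real n) \<longlonglongrightarrow> max 0 s" by simp
  qed simp
  then have "(\<lambda>n. f (real (k n s) / real n) \<omega>) \<longlonglongrightarrow> f (max 0 s) \<omega>"
    by (rule continuous_on_tendsto_compose[OF cont[OF \<omega>]]) auto
  then show "(\<lambda>n. case z of (\<omega>, s) \<Rightarrow> f (real (k n s) / real n) \<omega>) \<longlonglongrightarrow> (case z of (\<omega>, s) \<Rightarrow> f (max 0 s) \<omega>)"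
    by (simp add: z)
qed

lemma borel_measurable_mollify:
  fixes f :: "real \<Rightarrow> 'w \<Rightarrow> 'b::euclidean_space"
  assumes \<rho>: "continuous_on UNIV \<rho>"
    and meas: "\<And>s. 0 \<le> s \<Longrightarrow> f s \<in> borel_measurable M"
    and cont: "\<And>\<omega>. \<omega> \<in> space M \<Longrightarrow> continuous_on {0..} (\<lambda>s. f s \<omega>)"
  shows "(\<lambda>\<omega>. mollify \<rho> \<delta> (\<lambda>s. f s \<omega>) t) \<in> borel_measurable M"
proof -
  have [measurable]: "\<rho> \<in> borel_measurable borel"
    by (rule borel_measurable_continuous_onI[OF \<rho>])
  note [measurable] = borel_measurable_Caratheodory[OF meas cont]
  have "(\<lambda>z. indicator {0..} (snd z) *\<^sub>R \<rho> ((snd z - t) / \<delta>) *\<^sub>R (case z of (\<omega>, s) \<Rightarrow> f (max 0 s) \<omega>))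
      \<in> borel_measurable (M \<Otimes>\<^sub>M lborel)"
    by measurable
  then have "(\<lambda>\<omega>. \<integral>s. indicator {0..} s *\<^sub>R \<rho> ((s - t) / \<delta>) *\<^sub>R f (max 0 s) \<omega> \<partial>lborel) \<in> borel_measurable M"
    by (intro lborel.borel_measurable_lebesgue_integral) (simp add: case_prod_beta)
  also have "(\<lambda>\<omega>. \<integral>s. indicator {0..} s *\<^sub>R \<rho> ((s - t) / \<delta>) *\<^sub>R f (max 0 s) \<omega> \<partial>lborel)
      = (\<lambda>\<omega>. \<integral>s. indicator {0..} s *\<^sub>R \<rho> ((s - t) / \<delta>) *\<^sub>R f s \<omega> \<partial>lborel)"
    by (intro ext Bochner_Integration.integral_cong) (auto simp: indicator_def)
  finally show ?thesis
    unfolding mollify_def set_lebesgue_integral_def by measurable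
qed

lemma mollified_wiener_velocity_regular:
  fixes w :: "real \<Rightarrow> 'w \<Rightarrow> real ^ 'n"
  assumes W: "standard_wiener_process M w" and \<rho>: "mollifier \<rho>" and \<delta>: "0 < \<delta>"
  shows "0 \<le> t \<Longrightarrow> (\<lambda>\<omega>. mollified_velocity \<rho> \<delta> (\<lambda>s. w s \<omega>) t) \<in> borel_measurable M"
    and "\<omega> \<in> space M \<Longrightarrow> continuous_on {0..T} (mollified_velocity \<rho> \<delta> (\<lambda>s. w s \<omega>))"
proof -
  obtain \<rho>' \<rho>'' K where D:
    "\<And>x. (\<rho> has_real_derivative \<rho>' x) (at x)" "\<And>x. (\<rho>' has_real_derivative \<rho>'' x) (at x)"
    "continuous_on UNIV \<rho>'" "continuous_on UNIV \<rho>''"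
    "\<And>x. x \<notin> {0..1} \<Longrightarrow> \<rho> x = 0" "\<And>x. x \<notin> {0..1} \<Longrightarrow> \<rho>' x = 0" "\<And>x. x \<notin> {0..1} \<Longrightarrow> \<rho>'' x = 0"
    "\<And>x. \<bar>\<rho>' x\<bar> \<le> K" "\<And>x. \<bar>\<rho>'' x\<bar> \<le> K"
    using mollifier_first_two_derivatives[OF \<rho>] by blast
  have meas: "w s \<in> borel_measurable M" if "0 \<le> s" for s
    using W that by (simp add: standard_wiener_process_def)
  have cont: "continuous_on {0..} (\<lambda>s. w s \<omega>)" if "\<omega> \<in> space M" for \<omega>
    using W that by (simp add: standard_wiener_process_def)
  have eq: "mollified_velocity \<rho> \<delta> (\<lambda>s. w s \<omega>) t = - (1 / \<delta>) *\<^sub>R mollify \<rho>' \<delta> (\<lambda>s. w s \<omega>) t"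
    if "\<omega> \<in> space M" "0 \<le> t" for \<omega> t
    by (rule mollified_velocity_eq_mollify[OF D(1,3,5,6) \<delta> cont[OF that(1)] that(2)])
  show "(\<lambda>\<omega>. mollified_velocity \<rho> \<delta> (\<lambda>s. w s \<omega>) t) \<in> borel_measurable M" if "0 \<le> t"
  proof -
    have "(\<lambda>\<omega>. - (1 / \<delta>) *\<^sub>R mollify \<rho>' \<delta> (\<lambda>s. w s \<omega>) t) \<in> borel_measurable M"
      by (intro borel_measurable_scaleR borel_measurable_const borel_measurable_mollify[OF D(3) meas cont])
    then show ?thesis
      by (subst measurable_cong[OF eq[OF _ that]]) auto
  qed
  show "continuous_on {0..T} (mollified_velocity \<rho> \<delta> (\<lambda>s. w s \<omega>))" if "\<omega> \<in> space M"
  proof -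
    have "continuous_on {0..} (mollify \<rho>' \<delta> (\<lambda>s. w s \<omega>))"
      by (rule continuous_on_vector_derivative)
        (use mollify_has_vector_derivative[OF D(2,4,6,7) \<delta> cont[OF that]] in auto)
    then have "continuous_on {0..T} (\<lambda>t. - (1 / \<delta>) *\<^sub>R mollify \<rho>' \<delta> (\<lambda>s. w s \<omega>) t)"
      by (intro continuous_intros) (auto intro: continuous_on_subset)
    then show ?thesis
      using eq[OF that] by (subst continuous_on_cong[OF refl]) auto
  qed
qed

section \<open>Bounded coefficients with bounded derivatives\<close>

text \<open>Extracts a common constant for the size, the derivative and, by the mean value inequality, the
  Lipschitz property.\<close>

lemma bounded_with_derivativeE:
  fixes f :: "'a::real_normed_vector \<Rightarrow> 'b::real_normed_vector"
  assumes "bounded_with_derivative f"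
  obtains f' K where "1 \<le> K" "\<And>x. (f has_derivative f' x) (at x)" "\<And>x. norm (f x) \<le> K"
    "\<And>x v. norm (f' x v) \<le> K * norm v" "\<And>x y. norm (f x - f y) \<le> K * norm (x - y)"
proof -
  define f' where "f' x = frechet_derivative f (at x)" for x
  have der: "(f has_derivative f' x) (at x)" for x
    using assms by (simp add: bounded_with_derivative_def f'_def frechet_derivative_works)
  obtain K1 where K1: "\<And>x. norm (f x) \<le> K1"
    using assms by (auto simp: bounded_with_derivative_def bounded_iff)
  obtain K2 where K2: "\<And>x. onorm (f' x) \<le> K2"
    using assms by (auto simp: bounded_with_derivative_def bdd_above_def f'_def)
  define K where "K = max 1 (max K1 K2)"
  have K: "1 \<le> K" "K1 \<le> K" "K2 \<le> K" by (auto simp: K_def)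
  show ?thesis
  proof (rule that[of K f', OF K(1) der])
    show "norm (f x) \<le> K" for x using K1[of x] K(2) by linarith
    show "norm (f' x v) \<le> K * norm v" for x v
      using onorm[OF has_derivative_bounded_linear[OF der], of x v]
        mult_right_mono[of "onorm (f' x)" K "norm v"] K2[of x] K(3) by fastforce
    show "norm (f x - f y) \<le> K * norm (x - y)" for x y
      by (rule differentiable_bound[of UNIV f f']) (use der K2 K(3) in \<open>auto intro: order_trans\<close>)
  qed
qed

lemma bounded_with_derivative_continuous:
  assumes "bounded_with_derivative f"
  shows "continuous_on UNIV f"
  using assms by (auto simp: bounded_with_derivative_def differentiable_imp_continuous_within
      continuous_at_imp_continuous_on)

lemma bounded_with_derivativeI:
  fixes f :: "'a::real_normed_vector \<Rightarrow> 'b::real_normed_vector"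
  assumes der: "\<And>x. (f has_derivative f' x) (at x)" and K: "\<And>x. norm (f x) \<le> K"
    and K': "\<And>x v. norm (f' x v) \<le> K' * norm v"
  shows "bounded_with_derivative f"
proof -
  have "onorm (f' x) \<le> max K' 0" for x
  proof (rule onorm_bound)
    show "norm (f' x v) \<le> max K' 0 * norm v" for v
      using K'[of x v] mult_right_mono[of K' "max K' 0" "norm v"] by simp
  qed simp
  moreover have "frechet_derivative f (at x) = f' x" for x
    using frechet_derivative_at[OF der] by simp
  ultimately show ?thesis
    using der K unfolding bounded_with_derivative_def bounded_iff bdd_above_def differentiable_def
    by auto
qed

lemma bounded_with_derivative_bilinear:
  fixes f :: "'a::real_normed_vector \<Rightarrow> 'b::real_normed_vector" and g :: "'a \<Rightarrow> 'c::real_normed_vector"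
    and mul :: "'b \<Rightarrow> 'c \<Rightarrow> 'd::real_normed_vector"
  assumes mul: "bounded_bilinear mul"
    and f: "bounded_with_derivative f" and g: "bounded_with_derivative g"
  shows "bounded_with_derivative (\<lambda>x. mul (f x) (g x))"
proof -
  interpret mul: bounded_bilinear mul by fact
  obtain f' K where F: "1 \<le> K" "\<And>x. (f has_derivative f' x) (at x)" "\<And>x. norm (f x) \<le> K"
    "\<And>x v. norm (f' x v) \<le> K * norm v"
    using f by (rule bounded_with_derivativeE) blast
  obtain g' L where G: "1 \<le> L" "\<And>x. (g has_derivative g' x) (at x)" "\<And>x. norm (g x) \<le> L"
    "\<And>x v. norm (g' x v) \<le> L * norm v"
    using g by (rule bounded_with_derivativeE) blast
  obtain B where B: "0 \<le> B" "\<And>a b. norm (mul a b) \<le> norm a * norm b * B"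
    using mul.nonneg_bounded by blast
  have est: "norm (mul a b) \<le> s * t * B" if "norm a \<le> s" "norm b \<le> t" for a b s t
    using that B(2)[of a b] B(1) mult_mono[OF that] norm_ge_zero[of a]
    by (meson mult_right_mono norm_ge_zero order_trans)
  show ?thesis
  proof (rule bounded_with_derivativeI[OF mul.FDERIV[OF F(2) G(2)]])
    show "norm (mul (f x) (g x)) \<le> K * L * B" for x
      by (rule est[OF F(3) G(3)])
    show "norm (mul (f x) (g' x v) + mul (f' x v) (g x)) \<le> (2 * K * L * B) * norm v" for x v
      using norm_triangle_mono[OF est[OF F(3)[of x] G(4)[of x v]] est[OF F(4)[of x v] G(3)[of x]]]
      by (simp add: algebra_simps)
  qed
qed

lemma bounded_with_derivative_inverse:
  fixes f :: "'a::real_normed_vector \<Rightarrow> real"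
  assumes f: "bounded_with_derivative f" and c: "0 < c" "\<And>x. c \<le> f x"
  shows "bounded_with_derivative (\<lambda>x. inverse (f x))"
proof -
  obtain f' K where F: "1 \<le> K" "\<And>x. (f has_derivative f' x) (at x)"
    "\<And>x v. norm (f' x v) \<le> K * norm v"
    using f by (rule bounded_with_derivativeE) blast
  have pos: "0 < f x" for x using c(2)[of x] c(1) by linarith
  have inv: "inverse (f x) \<le> inverse c" for x using c(2)[of x] c(1) by (rule le_imp_inverse_le)
  show ?thesis
  proof (rule bounded_with_derivativeI)
    show "((\<lambda>x. inverse (f x)) has_derivative (\<lambda>v. - (inverse (f x) * f' x v * inverse (f x)))) (at x)" for x
      using F(2)[of x] pos[of x] by (intro Deriv.has_derivative_inverse) auto
    show "norm (inverse (f x)) \<le> inverse c" for x using inv[of x] pos[of x] by simp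
    show "norm (- (inverse (f x) * f' x v * inverse (f x))) \<le> (inverse c * K * inverse c) * norm v" for x v
    proof -
      have "norm (- (inverse (f x) * f' x v * inverse (f x))) = inverse (f x) * norm (f' x v) * inverse (f x)"
        using pos[of x] by (simp add: abs_mult)
      also have "\<dots> \<le> inverse c * (K * norm v) * inverse c"
        using pos[of x] inv[of x] F c(1) by (intro mult_mono) (auto intro: less_imp_le)
      finally show ?thesis by (simp add: mult_ac)
    qed
  qed
qed

lemma bounded_bilinear_matrix_vector:
  "bounded_bilinear ((*v) :: real ^ 'n ^ 'm \<Rightarrow> real ^ 'n \<Rightarrow> real ^ 'm)"
  unfolding bilinear_conv_bounded_bilinear[symmetric] bilinear_def
  by (auto intro!: linearI simp: matrix_vector_mult_add_rdistrib matrix_vector_right_distrib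
      scaleR_matrix_vector_assoc matrix_vector_mult_scaleR)

lemmas continuous_on_matrix_vector = bounded_bilinear.continuous_on[OF bounded_bilinear_matrix_vector]

text \<open>The chain rule along a curve, in the mixed form (total derivative outside, vector derivative
  inside) in which it is used below.\<close>

lemma has_derivative_comp_has_vector_derivative:
  assumes "(f has_derivative f') (at (q t))" and "(q has_vector_derivative v) (at t within S)"
  shows "((\<lambda>t. f (q t)) has_vector_derivative f' v) (at t within S)"
proof -
  interpret f': bounded_linear f' using assms(1) by (rule has_derivative_bounded_linear)
  have "((\<lambda>t. f (q t)) has_derivative (\<lambda>h. f' (h *\<^sub>R v))) (at t within S)"
    using assms(2) unfolding has_vector_derivative_def
    by (rule has_derivative_compose[where f = q and g = f, OF _ assms(1)])
  then show ?thesis by (simp add: has_vector_derivative_def f'.scaleR)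
qed

text \<open>The right-hand side of the first-order equation has this form.  The dependence on the driving
  velocity is kept explicit, because that velocity is of order \<open>1 / \<delta>\<close> and its size enters the exponential
  of the final estimate.\<close>

lemma driven_field_estimates:
  fixes h :: "'a::real_normed_vector \<Rightarrow> real ^ 'n" and H :: "'a \<Rightarrow> real ^ 'm ^ 'n"
    and A :: "real ^ 'n ^ 'k"
  assumes h: "bounded_with_derivative h" and H: "bounded_with_derivative H"
  defines "F \<equiv> \<lambda>x v. A *v (h x + H x *v v)"
  obtains K where "1 \<le> K" "\<And>x v. norm (F x v) \<le> K * (1 + norm v)"
    "\<And>x y v. norm (F x v - F y v) \<le> K * (1 + norm v) * norm (x - y)"
    "\<And>q p u u' t S. (q has_vector_derivative p) (at t within S) \<Longrightarrow>
       (u has_vector_derivative u') (at t within S) \<Longrightarrow>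
       \<exists>z'. ((\<lambda>t. F (q t) (u t)) has_vector_derivative z') (at t within S) \<and>
            norm z' \<le> K * (1 + norm (u t)) * norm p + K * norm u'"
proof -
  interpret mv: bounded_bilinear "(*v) :: real ^ 'm ^ 'n \<Rightarrow> real ^ 'm \<Rightarrow> real ^ 'n"
    by (rule bounded_bilinear_matrix_vector)
  interpret A: bounded_linear "(*v) A" by simp
  obtain h' K1 where h': "1 \<le> K1" "\<And>x. (h has_derivative h' x) (at x)" "\<And>x. norm (h x) \<le> K1"
    "\<And>x v. norm (h' x v) \<le> K1 * norm v" "\<And>x y. norm (h x - h y) \<le> K1 * norm (x - y)"
    using h by (rule bounded_with_derivativeE) blast
  obtain H' K2 where H': "1 \<le> K2" "\<And>x. (H has_derivative H' x) (at x)" "\<And>x. norm (H x) \<le> K2"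
    "\<And>x v. norm (H' x v) \<le> K2 * norm v" "\<And>x y. norm (H x - H y) \<le> K2 * norm (x - y)"
    using H by (rule bounded_with_derivativeE) blast
  obtain B where B: "0 < B" "\<And>a b. norm (a *v b :: real ^ 'n) \<le> norm (a :: real ^ 'm ^ 'n) * norm b * B"
    using mv.pos_bounded by blast
  obtain C where C: "0 < C" "\<And>x. norm (A *v x) \<le> norm x * C"
    using A.pos_bounded by blast
  define k where "k = K1 + K2 * B"
  have k: "K1 \<le> k" "K2 * B \<le> k" "0 \<le> k" using h'(1) H'(1) B(1) by (auto simp: k_def)
  define K where "K = max 1 (k * C)"
  have K: "1 \<le> K" "k * C \<le> K" by (auto simp: K_def)
  have key: "norm (A *v (a + N *v v)) \<le> K * (1 + norm v) * d"
    if "norm a \<le> K1 * d" "norm N \<le> K2 * d" "0 \<le> d" for a :: "real ^ 'n" and N :: "real ^ 'm ^ 'n" and v d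
  proof -
    have "norm N * norm v * B \<le> (K2 * d) * norm v * B"
      using that B(1) by (intro mult_right_mono) auto
    then have "norm (N *v v) \<le> (K2 * B) * (norm v * d)"
      using B(2)[of N v] by (simp add: mult_ac)
    also have "\<dots> \<le> k * (norm v * d)"
      using k that by (intro mult_right_mono) auto
    finally have "norm (a + N *v v) \<le> k * (1 + norm v) * d"
      using that(1) mult_right_mono[OF k(1) that(3)] norm_triangle_ineq[of a "N *v v"]
      by (simp add: algebra_simps)
    then have "norm (A *v (a + N *v v)) \<le> (k * (1 + norm v) * d) * C"
      by (rule order_trans[OF C(2) mult_right_mono]) (use C(1) in simp)
    also have "\<dots> = (k * C) * ((1 + norm v) * d)" by (simp add: mult_ac)
    also have "\<dots> \<le> K * ((1 + norm v) * d)" using K that by (intro mult_right_mono) auto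
    finally show ?thesis by (simp add: mult_ac)
  qed
  show ?thesis
  proof (rule that[of K, OF K(1)])
    show "norm (F x v) \<le> K * (1 + norm v)" for x v
      unfolding F_def using key[of "h x" 1 "H x" v] h'(3) H'(3) by simp
    show "norm (F x v - F y v) \<le> K * (1 + norm v) * norm (x - y)" for x y v
    proof -
      have "F x v - F y v = A *v ((h x - h y) + (H x - H y) *v v)"
        unfolding F_def A.diff[symmetric] mv.diff_left by (simp add: algebra_simps)
      then show ?thesis using key[OF h'(5) H'(5)] by simp
    qed
    fix q :: "real \<Rightarrow> 'a" and u :: "real \<Rightarrow> real ^ 'm" and p u' t S
    assume q: "(q has_vector_derivative p) (at t within S)"
      and u: "(u has_vector_derivative u') (at t within S)"
    define z' where "z' = A *v (h' (q t) p + (H (q t) *v u' + H' (q t) p *v u t))"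
    have "((\<lambda>t. F (q t) (u t)) has_vector_derivative z') (at t within S)"
      unfolding F_def z'_def
      by (intro A.has_vector_derivative has_vector_derivative_add mv.has_vector_derivative u
          has_derivative_comp_has_vector_derivative[OF h'(2) q]
          has_derivative_comp_has_vector_derivative[OF H'(2) q])
    moreover have "norm z' \<le> K * (1 + norm (u t)) * norm p + K * norm u'"
    proof -
      have z': "z' = A *v (h' (q t) p + H' (q t) p *v u t) + A *v (0 + H (q t) *v u')"
        unfolding z'_def A.add[symmetric] by (simp add: add_ac)
      have 1: "norm (A *v (h' (q t) p + H' (q t) p *v u t)) \<le> K * (1 + norm (u t)) * norm p"
        by (rule key[OF h'(4) H'(4)]) simp
      have 2: "norm (A *v (0 + H (q t) *v u')) \<le> K * norm u'"
      proof -
        have "norm (H (q t)) * norm u' * B \<le> K2 * norm u' * B"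
          using H'(3) B(1) by (intro mult_right_mono) auto
        then have "norm (H (q t) *v u') \<le> (K2 * B) * norm u'"
          using B(2)[of "H (q t)" u'] by (simp add: mult_ac)
        also have "\<dots> \<le> k * norm u'" using k by (intro mult_right_mono) auto
        finally have "norm (A *v (H (q t) *v u')) \<le> k * norm u' * C"
          by (intro order_trans[OF C(2) mult_right_mono]) (use C(1) in auto)
        also have "\<dots> \<le> K * norm u'"
          using mult_right_mono[OF K(2) norm_ge_zero[of u']] by (simp add: mult_ac)
        finally show ?thesis by simp
      qed
      show ?thesis unfolding z' by (rule norm_triangle_mono[OF 1 2])
    qed
    ultimately show "\<exists>z'. ((\<lambda>t. F (q t) (u t)) has_vector_derivative z') (at t within S) \<and>
            norm z' \<le> K * (1 + norm (u t)) * norm p + K * norm u'" by blast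
  qed
qed

section \<open>Relaxation of the momentum under a strong magnetic force\<close>

text \<open>A Gronwall estimate that constrains only the component of the velocity along \<open>x\<close>.  Rotations are
  thereby free, however fast they are; this is what makes the estimates uniform in the mass.\<close>

lemma Gronwall_inner:
  fixes x x' :: "real \<Rightarrow> 'a::real_inner"
  assumes der: "\<And>s. s \<in> {0..T} \<Longrightarrow> (x has_vector_derivative x' s) (at s within {0..T})"
    and ineq: "\<And>s. s \<in> {0..T} \<Longrightarrow> x s \<bullet> x' s \<le> norm (x s) * (a * norm (x s) + c)"
    and a: "0 \<le> a" and c: "0 \<le> c" and t: "t \<in> {0..T}"
  shows "norm (x t) \<le> exp ((a + 1) * T) * (norm (x 0) + c)"
proof -
  \<comment> \<open>The squared norm is differentiable where the norm is not.  The additional \<open>1\<close> in the damping rate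
    pays for the term \<open>2 c |x| \<le> |x|\<^sup>2 + c\<^sup>2\<close>.\<close>
  define \<phi> where "\<phi> s = exp (- (2 * a + 1) * s) * (x s \<bullet> x s) - c\<^sup>2 * s" for s
  define \<phi>' where "\<phi>' s = exp (- (2 * a + 1) * s) * (2 * (x s \<bullet> x' s) - (2 * a + 1) * (x s \<bullet> x s)) - c\<^sup>2" for s
  have d: "(\<phi> has_real_derivative \<phi>' s) (at s within {0..T})" if "s \<in> {0..T}" for s
  proof -
    have x: "(x has_derivative (\<lambda>h. h *\<^sub>R x' s)) (at s within {0..T})"
      using der[OF that] by (simp add: has_vector_derivative_def)
    have "((\<lambda>s. x s \<bullet> x s) has_derivative (\<lambda>h. x s \<bullet> (h *\<^sub>R x' s) + (h *\<^sub>R x' s) \<bullet> x s)) (at s within {0..T})"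
      by (rule has_derivative_inner[OF x x])
    also have "(\<lambda>h. x s \<bullet> (h *\<^sub>R x' s) + (h *\<^sub>R x' s) \<bullet> x s) = (*) (2 * (x s \<bullet> x' s))"
      by (simp add: fun_eq_iff inner_commute[of "x' s"])
    finally have i: "((\<lambda>s. x s \<bullet> x s) has_real_derivative 2 * (x s \<bullet> x' s)) (at s within {0..T})"
      by (simp add: has_field_derivative_def)
    have "((\<lambda>s. exp (- (2 * a + 1) * s)) has_real_derivative exp (- (2 * a + 1) * s) * (- (2 * a + 1)))
        (at s within {0..T})"
      by (rule derivative_eq_intros refl)+ simp
    from DERIV_diff[OF DERIV_mult[OF this i] DERIV_cmult[OF DERIV_ident, of "c\<^sup>2"]]
    show ?thesis
      unfolding \<phi>_def \<phi>'_def by (simp add: algebra_simps)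
  qed
  have neg: "\<phi>' s \<le> 0" if "s \<in> {0..T}" for s
  proof -
    have e: "0 \<le> exp (- (2 * a + 1) * s)" "exp (- (2 * a + 1) * s) \<le> 1"
      using that a mult_nonpos_nonneg[of "- (2 * a + 1)" s] by auto
    have "0 \<le> (norm (x s) - c)\<^sup>2" by simp
    then have "2 * (x s \<bullet> x' s) - (2 * a + 1) * (x s \<bullet> x s) \<le> c\<^sup>2"
      using ineq[OF that] by (simp add: power2_norm_eq_inner[symmetric] power2_eq_square algebra_simps)
    then have "exp (- (2 * a + 1) * s) * (2 * (x s \<bullet> x' s) - (2 * a + 1) * (x s \<bullet> x s))
        \<le> exp (- (2 * a + 1) * s) * c\<^sup>2"
      using e by (intro mult_left_mono) auto
    also have "\<dots> \<le> 1 * c\<^sup>2"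
      using e by (intro mult_right_mono) auto
    finally show ?thesis by (simp add: \<phi>'_def)
  qed
  have "\<phi> t \<le> \<phi> 0"
  proof (cases "t = 0")
    case False
    show ?thesis
    proof (rule DERIV_nonpos_imp_decreasing_open[of 0 t \<phi>])
      show "0 \<le> t" using t by simp
      fix s assume s: "0 < s" "s < t"
      with t have "(\<phi> has_real_derivative \<phi>' s) (at s)"
        using d[of s] by (simp add: at_within_Icc_at)
      with neg[of s] s t show "\<exists>y. (\<phi> has_real_derivative y) (at s) \<and> y \<le> 0" by auto
    next
      have "continuous_on {0..T} \<phi>" by (rule DERIV_continuous_on[OF d])
      then show "continuous_on {0..t} \<phi>" by (rule continuous_on_subset) (use t in auto)
    qed
  qed simp
  then have "exp (- (2 * a + 1) * t) * (norm (x t))\<^sup>2 \<le> (norm (x 0))\<^sup>2 + c\<^sup>2 * t"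
    by (simp add: \<phi>_def power2_norm_eq_inner)
  also have "\<dots> \<le> (norm (x 0))\<^sup>2 * (1 + t) + c\<^sup>2 * (1 + t)"
    using t by (intro add_mono mult_left_mono) (auto simp: mult_le_cancel_left1)
  also have "\<dots> = ((norm (x 0))\<^sup>2 + c\<^sup>2) * (1 + t)"
    by (simp only: distrib_right)
  also have "\<dots> \<le> (norm (x 0) + c)\<^sup>2 * (1 + t)"
    using t c by (intro mult_right_mono) (auto simp: power2_sum)
  also have "\<dots> \<le> (norm (x 0) + c)\<^sup>2 * exp t"
    by (intro mult_left_mono exp_ge_add_one_self) auto
  finally have damped: "exp (- (2 * a + 1) * t) * (norm (x t))\<^sup>2 \<le> (norm (x 0) + c)\<^sup>2 * exp t" .
  have "exp ((2 * a + 1) * t) * exp (- (2 * a + 1) * t) = 1"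
    by (simp add: mult_exp_exp algebra_simps)
  then have "(norm (x t))\<^sup>2 = exp ((2 * a + 1) * t) * (exp (- (2 * a + 1) * t) * (norm (x t))\<^sup>2)"
    by (simp only: mult.assoc[symmetric] mult_1)
  also have "\<dots> \<le> exp ((2 * a + 1) * t) * ((norm (x 0) + c)\<^sup>2 * exp t)"
    using damped by (rule mult_left_mono) simp
  also have "\<dots> = (exp ((2 * a + 1) * t) * exp t) * (norm (x 0) + c)\<^sup>2"
    by (simp only: mult_ac)
  also have "exp ((2 * a + 1) * t) * exp t = (exp ((a + 1) * t))\<^sup>2"
    by (simp add: mult_exp_exp exp_double[symmetric] algebra_simps)
  also have "\<dots> * (norm (x 0) + c)\<^sup>2 = (exp ((a + 1) * t) * (norm (x 0) + c))\<^sup>2"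
    by (simp only: power_mult_distrib)
  finally have "(norm (x t))\<^sup>2 \<le> (exp ((a + 1) * t) * (norm (x 0) + c))\<^sup>2" .
  then have "norm (x t) \<le> exp ((a + 1) * t) * (norm (x 0) + c)"
    by (rule power2_le_imp_le) (use c in auto)
  also have "\<dots> \<le> exp ((a + 1) * T) * (norm (x 0) + c)"
    using t a c by (intro mult_right_mono) (auto intro: mult_left_mono)
  finally show ?thesis .
qed

text \<open>The core of the argument, for one path.  Here \<open>z\<close> is the velocity that the first-order field
  prescribes at the position of the second-order solution, and the hypothesis on \<open>p'\<close> is the
  second-order equation solved for the rotation of \<open>p - z\<close>.  There are two steps.

  The deviation \<open>r = p - z\<close> satisfies \<open>r' = (\<mu> \<beta>)\<inverse> J r - z'\<close>.  The first term rotates \<open>r\<close> rapidly but does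
  not change its length, and \<open>z'\<close> is bounded by an affine function of the length of \<open>p\<close>.  Gronwall's
  lemma therefore bounds \<open>p\<close> by the constant \<open>P\<close>, uniformly in \<open>\<mu>\<close>.

  Since \<open>r = - \<mu> \<beta> J p'\<close>, the velocity of \<open>q\<close> is \<open>z\<close> minus \<open>\<mu> \<beta> J p'\<close>.  Adding the corrector \<open>\<mu> \<beta> J p\<close> to
  \<open>q - ql\<close> removes \<open>p'\<close> and leaves an error \<open>\<mu> \<beta>' J p\<close> of order \<open>\<mu> P\<^sup>2\<close>, so a second application of
  Gronwall's lemma gives a difference of order \<open>\<mu>\<close>.\<close>

lemma magnetic_relaxation_estimate:
  fixes q p p' z z' ql zl :: "real \<Rightarrow> 'a::real_inner" and J :: "'a \<Rightarrow> 'a"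
  assumes J: "bounded_linear J" "\<And>v. norm (J v) = norm v" "\<And>v. J (J v) = - v" "\<And>v. v \<bullet> J v = 0"
    and \<mu>: "0 < \<mu>"
    and q: "\<And>t. t \<in> {0..T} \<Longrightarrow> (q has_vector_derivative p t) (at t within {0..T})"
    and p: "\<And>t. t \<in> {0..T} \<Longrightarrow> (p has_vector_derivative p' t) (at t within {0..T})"
    and newton: "\<And>t. t \<in> {0..T} \<Longrightarrow> (\<mu> * \<beta> t) *\<^sub>R p' t = J (p t - z t)"
    and ql: "\<And>t. t \<in> {0..T} \<Longrightarrow> (ql has_vector_derivative zl t) (at t within {0..T})"
    and start: "q 0 = ql 0"
    and z: "\<And>t. t \<in> {0..T} \<Longrightarrow> (z has_vector_derivative z' t) (at t within {0..T})"
    and z_le: "\<And>t. t \<in> {0..T} \<Longrightarrow> norm (z t) \<le> a"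
    and z'_le: "\<And>t. t \<in> {0..T} \<Longrightarrow> norm (z' t) \<le> a * norm (p t) + c"
    and lip: "\<And>t. t \<in> {0..T} \<Longrightarrow> norm (z t - zl t) \<le> a * norm (q t - ql t)"
    and \<beta>: "\<And>t. t \<in> {0..T} \<Longrightarrow> (\<beta> has_vector_derivative \<beta>' t) (at t within {0..T})"
    and \<beta>_le: "\<And>t. t \<in> {0..T} \<Longrightarrow> 0 < \<beta> t \<and> \<beta> t \<le> K"
    and \<beta>'_le: "\<And>t. t \<in> {0..T} \<Longrightarrow> \<bar>\<beta>' t\<bar> \<le> K * norm (p t)"
    and a: "0 \<le> a" and c: "0 \<le> c" and t: "t \<in> {0..T}"
  defines "P \<equiv> exp ((a + 1) * T) * (norm (p 0) + a + a\<^sup>2 + c) + a"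
  shows "norm (q t - ql t) \<le> \<mu> * (K * P * (exp ((a + 1) * T) * (1 + a + P) + 1))"
proof -
  interpret J: bounded_linear J by fact
  have T: "0 \<in> {0..T}" "0 \<le> T" using t by auto
  have K: "0 \<le> K" using \<beta>_le[OF T(1)] by linarith
  have p_le: "norm (p s) \<le> P" if s: "s \<in> {0..T}" for s
  proof -
    \<comment> \<open>The fast variable: the deviation of the momentum from its quasi-stationary value.\<close>
    define r where "r s = p s - z s" for s
    have r_le: "norm (r s) \<le> exp ((a + 1) * T) * (norm (r 0) + (a\<^sup>2 + c))"
    proof (rule Gronwall_inner[OF _ _ a _ s])
      show "(r has_vector_derivative p' s - z' s) (at s within {0..T})" if "s \<in> {0..T}" for s
        unfolding r_def using p[OF that] z[OF that] by (rule has_vector_derivative_diff)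
      show "r s \<bullet> (p' s - z' s) \<le> norm (r s) * (a * norm (r s) + (a\<^sup>2 + c))" if "s \<in> {0..T}" for s
      proof -
        have "(\<mu> * \<beta> s) * (r s \<bullet> p' s) = r s \<bullet> J (r s)"
          using newton[OF that] by (simp add: r_def inner_scaleR_right[symmetric])
        then have "r s \<bullet> p' s = 0" using J(4) \<mu> \<beta>_le[OF that] by auto
        then have "r s \<bullet> (p' s - z' s) \<le> norm (r s) * norm (z' s)"
          using norm_cauchy_schwarz[of "- r s" "z' s"] by (simp add: inner_diff_right)
        also have "norm (p s) \<le> norm (r s) + a"
          using norm_triangle_ineq[of "r s" "z s"] z_le[OF that] by (simp add: r_def)
        then have "norm (z' s) \<le> a * norm (r s) + (a\<^sup>2 + c)"
          using z'_le[OF that] mult_left_mono[OF _ a, of "norm (p s)" "norm (r s) + a"]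
          by (simp add: algebra_simps power2_eq_square)
        finally show ?thesis by (simp add: mult_left_mono)
      qed
    qed (use c in auto)
    have "norm (r 0) \<le> norm (p 0) + a"
      using norm_triangle_ineq4[of "p 0" "z 0"] z_le[OF T(1)] by (simp add: r_def)
    then have "exp ((a + 1) * T) * (norm (r 0) + (a\<^sup>2 + c)) \<le> exp ((a + 1) * T) * (norm (p 0) + a + a\<^sup>2 + c)"
      by (intro mult_left_mono) auto
    moreover have "norm (p s) \<le> norm (r s) + norm (z s)"
      using norm_triangle_ineq[of "r s" "z s"] by (simp add: r_def)
    ultimately show ?thesis
      using z_le[OF s] r_le unfolding P_def by linarith
  qed
  have P: "0 \<le> P" using p_le[OF T(1)] norm_ge_zero[of "p 0"] by linarith
  \<comment> \<open>The corrector.  Its derivative contains the large quantity \<open>p'\<close> with exactly the factor that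
    cancels the fast variable.\<close>
  define B where "B s = \<mu> *\<^sub>R \<beta> s *\<^sub>R J (p s)" for s
  have B_le: "norm (B s) \<le> \<mu> * (K * P)" if "s \<in> {0..T}" for s
    using \<beta>_le[OF that] p_le[OF that] \<mu> K by (simp add: B_def J(2) mult_mono)
  define D where "D s = q s - ql s + B s" for s
  define D' where "D' s = z s - zl s + \<mu> *\<^sub>R \<beta>' s *\<^sub>R J (p s)" for s
  have "norm (D t) \<le> exp ((a + 1) * T) * (norm (D 0) + \<mu> * (K * P * (a + P)))"
  proof (rule Gronwall_inner[OF _ _ a _ t])
    fix s assume s: "s \<in> {0..T}"
    have "(D has_vector_derivative p s - zl s + \<mu> *\<^sub>R (\<beta> s *\<^sub>R J (p' s) + \<beta>' s *\<^sub>R J (p s)))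
        (at s within {0..T})"
      unfolding D_def B_def
      by (intro has_vector_derivative_add has_vector_derivative_diff q ql s
          bounded_linear.has_vector_derivative[OF bounded_linear_scaleR_right]
          has_vector_derivative_scaleR[OF \<beta>[OF s, folded has_real_derivative_iff_has_vector_derivative]]
          J.has_vector_derivative p)
    moreover have "\<mu> *\<^sub>R \<beta> s *\<^sub>R J (p' s) = z s - p s"
      using arg_cong[OF newton[OF s], of J] J(3) by (simp add: J.scaleR)
    then have "p s - zl s + \<mu> *\<^sub>R (\<beta> s *\<^sub>R J (p' s) + \<beta>' s *\<^sub>R J (p s)) = D' s"
      unfolding D'_def scaleR_add_right by simp
    ultimately show "(D has_vector_derivative D' s) (at s within {0..T})"
      by simp
    have "norm (D' s) \<le> a * norm (q s - ql s) + \<mu> * (K * P * P)"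
    proof -
      have "\<bar>\<beta>' s\<bar> \<le> K * P"
        using \<beta>'_le[OF s] mult_left_mono[OF p_le[OF s] K] by linarith
      then have "\<bar>\<beta>' s\<bar> * norm (p s) \<le> K * P * P"
        using p_le[OF s] K P by (intro mult_mono) auto
      then have "norm (\<mu> *\<^sub>R \<beta>' s *\<^sub>R J (p s)) \<le> \<mu> * (K * P * P)"
        using \<mu> by (simp add: J(2) abs_mult mult.assoc)
      then show ?thesis
        unfolding D'_def by (intro norm_triangle_mono lip s)
    qed
    moreover have "norm (q s - ql s) \<le> norm (D s) + \<mu> * (K * P)"
      using norm_triangle_ineq4[of "D s" "B s"] B_le[OF s] by (simp add: D_def)
    then have "a * norm (q s - ql s) \<le> a * norm (D s) + \<mu> * (K * P * a)"
      using a mult_left_mono by (fastforce simp: algebra_simps)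
    ultimately have "norm (D' s) \<le> a * norm (D s) + \<mu> * (K * P * (a + P))"
      by (simp add: algebra_simps)
    then show "D s \<bullet> D' s \<le> norm (D s) * (a * norm (D s) + \<mu> * (K * P * (a + P)))"
      using norm_cauchy_schwarz[of "D s" "D' s"] mult_left_mono[OF _ norm_ge_zero[of "D s"]]
      by (meson order_trans)
  qed (use \<mu> K P a in auto)
  moreover have "norm (D 0) \<le> \<mu> * (K * P)"
    using B_le[OF T(1)] start by (simp add: D_def)
  ultimately have "norm (D t) \<le> exp ((a + 1) * T) * (\<mu> * (K * P) + \<mu> * (K * P * (a + P)))"
    by (meson add_right_mono exp_ge_zero mult_left_mono order_trans)
  moreover have "norm (q t - ql t) \<le> norm (D t) + \<mu> * (K * P)"
    using norm_triangle_ineq4[of "D t" "B t"] B_le[OF t] by (simp add: D_def)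
  ultimately show ?thesis by (simp add: algebra_simps)
qed

text \<open>All polynomial factors of the constant above are absorbed by a multiple of the exponent.\<close>

lemma relaxation_constant_le_exp:
  fixes T :: real
  assumes T: "0 \<le> T" and a: "0 \<le> a" "a \<le> L * y" and c: "0 \<le> c" "c \<le> (L * y)\<^sup>2"
    and e: "(a + 1) * T \<le> L * y" and \<Lambda>: "0 \<le> \<Lambda>" and K: "0 \<le> K"
  defines "P \<equiv> exp ((a + 1) * T) * (\<Lambda> + a + a\<^sup>2 + c) + a"
  shows "K * P * (exp ((a + 1) * T) * (1 + a + P) + 1) \<le> K * (\<Lambda> + 7)\<^sup>2 * exp (7 * L * y)"
proof -
  \<comment> \<open>Every quantity is at most a multiple of a power of \<open>E \<ge> 1\<close>, since \<open>x \<le> exp x\<close>.\<close>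
  define E where "E = exp (L * y)"
  have Ly: "0 \<le> L * y" using a by linarith
  have E1: "1 \<le> E" using Ly by (simp add: E_def)
  have yE: "L * y \<le> E" unfolding E_def using exp_ge_add_one_self[of "L * y"] by linarith
  have aE: "a \<le> E" using a yE by linarith
  have a2: "a\<^sup>2 \<le> E\<^sup>2" using aE a by (intro power_mono)
  have cE: "c \<le> E\<^sup>2" using c power_mono[OF yE Ly, of 2] by linarith
  have eE: "exp ((a + 1) * T) \<le> E" using e by (simp add: E_def)
  have pw: "E ^ i \<le> E ^ j" if "i \<le> j" for i j using E1 that by (rule power_increasing[rotated])
  have "P \<le> E * (\<Lambda> + E + E\<^sup>2 + E\<^sup>2) + E"
    unfolding P_def using eE aE a2 cE a c \<Lambda> E1 by (intro add_mono mult_mono) auto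
  also have "\<dots> = \<Lambda> * E ^ 1 + E ^ 2 + 2 * E ^ 3 + E ^ 1"
    by (simp add: algebra_simps power2_eq_square power3_eq_cube)
  also have "\<dots> \<le> \<Lambda> * E ^ 3 + E ^ 3 + 2 * E ^ 3 + E ^ 3"
    by (intro add_mono mult_left_mono pw \<Lambda>) auto
  finally have PE: "P \<le> (\<Lambda> + 4) * E ^ 3" by (simp add: algebra_simps)
  have P0: "0 \<le> P" unfolding P_def using a c \<Lambda> by simp
  have "exp ((a + 1) * T) * (1 + a + P) + 1 \<le> E * (E + E + (\<Lambda> + 4) * E ^ 3) + E"
    using eE aE PE E1 a P0 by (intro add_mono mult_mono) auto
  also have "\<dots> = 2 * E ^ 2 + (\<Lambda> + 4) * E ^ 4 + E ^ 1"
    by (simp add: algebra_simps power2_eq_square power3_eq_cube power4_eq_xxxx)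
  also have "\<dots> \<le> 2 * E ^ 4 + (\<Lambda> + 4) * E ^ 4 + E ^ 4"
    by (intro add_mono mult_left_mono pw) (use \<Lambda> in auto)
  finally have Q: "exp ((a + 1) * T) * (1 + a + P) + 1 \<le> (\<Lambda> + 7) * E ^ 4" by (simp add: algebra_simps)
  have "P * (exp ((a + 1) * T) * (1 + a + P) + 1) \<le> ((\<Lambda> + 4) * E ^ 3) * ((\<Lambda> + 7) * E ^ 4)"
    using PE Q P0 a by (intro mult_mono) auto
  also have "\<dots> = ((\<Lambda> + 4) * (\<Lambda> + 7)) * E ^ 7"
    by (simp add: power_add[symmetric])
  also have "\<dots> \<le> (\<Lambda> + 7)\<^sup>2 * E ^ 7"
    unfolding power2_eq_square using \<Lambda> E1 by (intro mult_right_mono) auto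
  also have "E ^ 7 = exp (7 * L * y)"
    by (simp add: E_def exp_of_nat_mult[symmetric] mult.assoc)
  finally show ?thesis
    using mult_left_mono[OF _ K] by (simp add: mult.assoc)
qed

section \<open>The convergence rate for a single path\<close>

text \<open>\<^const>\<open>A0\<close> is the rotation by a right angle: an isometry, a square root of \<open>-1\<close>, and orthogonal to
  every velocity.  The orthogonality is why the magnetic force performs no work.\<close>

lemma A0_mult_vec:
  "norm (A0 *v x) = norm x" "A0 *v (A0 *v x) = - x" "x \<bullet> (A0 *v x) = 0"
  by (simp_all add: A0_def matrix_vector_mult_def vec_eq_iff forall_2 sum_2 inner_vec_def
      norm_eq_sqrt_inner)

lemma matrix_inv_scaled_A0:
  assumes "c \<noteq> 0"
  shows "matrix_inv (c *\<^sub>R A0) = - inverse c *\<^sub>R A0"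
proof -
  define A where "A = c *\<^sub>R A0"
  define B where "B = - inverse c *\<^sub>R A0"
  have "A *v (B *v x) = x" "B *v (A *v x) = x" for x
    unfolding A_def B_def scaleR_matrix_vector_assoc[symmetric] matrix_vector_mult_scaleR A0_mult_vec
    using assms by simp_all
  then have AB: "A ** B = mat 1" "B ** A = mat 1"
    by (simp_all add: matrix_eq matrix_vector_mul_assoc[symmetric])
  then have "A ** matrix_inv A = mat 1 \<and> matrix_inv A ** A = mat 1"
    unfolding matrix_inv_def by (rule_tac someI[of _ B]) simp
  then have "B ** (A ** matrix_inv A) = B" by simp
  moreover have "B ** (A ** matrix_inv A) = matrix_inv A"
    unfolding matrix_mul_assoc AB by simp
  ultimately show ?thesis by (simp add: A_def B_def)
qed

text \<open>Because \<open>A0\<close> is a square root of \<open>-1\<close>, the inverse of \<open>a A0\<close> is \<open>-A0 / a\<close>; both equations can thus be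
  written with the coefficients \<open>b / \<alpha>\<close> and \<open>\<sigma> / \<alpha>\<close>.\<close>

lemma first_order_field_eq:
  assumes "A = a *\<^sub>R A0" "a \<noteq> 0"
  shows "- (matrix_inv A *v b) - matrix_inv A *v (S *v v)
      = A0 *v (inverse a *\<^sub>R b + (inverse a *\<^sub>R S) *v v)"
proof -
  have inv: "matrix_inv A *v x = - (inverse a *\<^sub>R (A0 *v x))" for x
    unfolding assms(1) matrix_inv_scaled_A0[OF assms(2)] scaleR_matrix_vector_assoc[symmetric] by simp
  show ?thesis
    unfolding inv scaleR_matrix_vector_assoc[symmetric] matrix_vector_right_distrib
      matrix_vector_mult_scaleR
    by simp
qed

text \<open>The comparison for a deterministic path \<open>f\<close> bounded by \<open>X\<close>.  The horizon \<open>T + 1\<close> appears because the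
  mollification at time \<open>t\<close> looks ahead to \<open>t + \<delta>\<close>.  The quantity in the exponent is the time times the
  size of the driving velocity.\<close>

lemma pathwise_convergence_rate:
  fixes b :: "real ^ 2 \<Rightarrow> real ^ 2" and \<sigma> :: "real ^ 2 \<Rightarrow> real ^ 2 ^ 2" and \<alpha> :: "real ^ 2 \<Rightarrow> real"
    and q0 p0 :: "real ^ 2"
  assumes \<rho>: "mollifier \<rho>"
    and b: "bounded_with_derivative b" and \<sigma>: "bounded_with_derivative \<sigma>"
    and \<alpha>: "bounded_with_derivative \<alpha>" and \<alpha>0: "0 < \<alpha>0" "\<And>x. \<alpha>0 \<le> \<alpha> x"
    and A: "\<And>x. A x = \<alpha> x *\<^sub>R A0"
  obtains C L :: real where "0 < C" "0 < L"
    "\<And>f T X \<mu> \<delta> q p ql t. continuous_on {0..} f \<Longrightarrow> (\<And>s. s \<in> {0..T + 1} \<Longrightarrow> norm (f s) \<le> X) \<Longrightarrow>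
       0 < \<mu> \<Longrightarrow> 0 < \<delta> \<Longrightarrow> \<delta> \<le> 1 \<Longrightarrow>
       second_order_solution b A \<sigma> \<mu> (mollified_velocity \<rho> \<delta> f) q0 p0 q p \<Longrightarrow>
       first_order_solution b A \<sigma> (mollified_velocity \<rho> \<delta> f) q0 ql \<Longrightarrow> t \<in> {0..T} \<Longrightarrow>
       norm (q t - ql t) \<le> C * exp (L * ((1 + T) * (1 + X) / \<delta>)) * \<mu>"
proof -
  define \<beta> where "\<beta> x = inverse (\<alpha> x)" for x
  define h where "h x = \<beta> x *\<^sub>R b x" for x
  define H where "H x = \<beta> x *\<^sub>R \<sigma> x" for x
  define F where "F x v = A0 *v (h x + H x *v v)" for x v
  have \<alpha>_pos: "0 < \<alpha> x" for x using \<alpha>0(1) \<alpha>0(2)[of x] by linarith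
  have bwd_\<beta>: "bounded_with_derivative \<beta>"
    unfolding \<beta>_def by (rule bounded_with_derivative_inverse[OF \<alpha> \<alpha>0])
  have bwd_h: "bounded_with_derivative h" and bwd_H: "bounded_with_derivative H"
    unfolding h_def H_def
    by (rule bounded_with_derivative_bilinear[OF bounded_bilinear_scaleR bwd_\<beta> b],
        rule bounded_with_derivative_bilinear[OF bounded_bilinear_scaleR bwd_\<beta> \<sigma>])
  obtain \<beta>' K\<beta> where \<beta>': "1 \<le> K\<beta>" "\<And>x. (\<beta> has_derivative \<beta>' x) (at x)" "\<And>x. norm (\<beta> x) \<le> K\<beta>"
    "\<And>x v. norm (\<beta>' x v) \<le> K\<beta> * norm v"
    using bwd_\<beta> by (rule bounded_with_derivativeE) blast
  obtain K where K: "1 \<le> K" "\<And>x v. norm (F x v) \<le> K * (1 + norm v)"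
    "\<And>x y v. norm (F x v - F y v) \<le> K * (1 + norm v) * norm (x - y)"
    "\<And>q p u u' t S. (q has_vector_derivative p) (at t within S) \<Longrightarrow>
       (u has_vector_derivative u') (at t within S) \<Longrightarrow>
       \<exists>z'. ((\<lambda>t. F (q t) (u t)) has_vector_derivative z') (at t within S) \<and>
            norm z' \<le> K * (1 + norm (u t)) * norm p + K * norm u'"
    unfolding F_def using driven_field_estimates[OF bwd_h bwd_H, of A0] by blast
  obtain \<kappa> where \<kappa>: "0 \<le> \<kappa>"
    "\<And>(f :: real \<Rightarrow> real ^ 2) \<delta> t X. continuous_on {0..} f \<Longrightarrow> 0 < \<delta> \<Longrightarrow> 0 \<le> t \<Longrightarrow>
       (\<And>s. s \<in> {t..t + \<delta>} \<Longrightarrow> norm (f s) \<le> X) \<Longrightarrow>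
       norm (mollified_velocity \<rho> \<delta> f t) \<le> \<kappa> * X / \<delta> \<and>
       (\<exists>u'. (mollified_velocity \<rho> \<delta> f has_vector_derivative u') (at t within {0..}) \<and>
             norm u' \<le> \<kappa> * X / \<delta>\<^sup>2)"
    using mollified_velocity_bounds[OF \<rho>] by blast
  define L where "L = K * (1 + \<kappa>) + 1"
  define C where "C = K\<beta> * (norm p0 + 7)\<^sup>2"
  show ?thesis
  proof (rule that[of C "7 * L"])
    have "0 < norm p0 + 7" using norm_ge_zero[of p0] by linarith
    then show "0 < C" using \<beta>'(1) by (simp add: C_def)
    have "0 \<le> K * (1 + \<kappa>)" using K(1) \<kappa>(1) by simp
    then show "0 < 7 * L" by (simp add: L_def)
    fix f :: "real \<Rightarrow> real ^ 2" and T X \<mu> \<delta> t :: real and q p ql :: "real \<Rightarrow> real ^ 2"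
    assume f: "continuous_on {0..} f" and X: "\<And>s. s \<in> {0..T + 1} \<Longrightarrow> norm (f s) \<le> X"
      and \<mu>: "0 < \<mu>" and \<delta>: "0 < \<delta>" "\<delta> \<le> 1"
      and so: "second_order_solution b A \<sigma> \<mu> (mollified_velocity \<rho> \<delta> f) q0 p0 q p"
      and fo: "first_order_solution b A \<sigma> (mollified_velocity \<rho> \<delta> f) q0 ql"
      and t: "t \<in> {0..T}"
    define u where "u = mollified_velocity \<rho> \<delta> f"
    define a where "a = K * (1 + \<kappa> * X / \<delta>)"
    define c where "c = K * (\<kappa> * X / \<delta>\<^sup>2)"
    have T: "0 \<le> T" using t by auto
    have X0: "0 \<le> X" using order_trans[OF norm_ge_zero X[of 0]] T by simp
    have bound: "norm (u s) \<le> \<kappa> * X / \<delta> \<and> (\<exists>u'. (u has_vector_derivative u') (at s within {0..}) \<and>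
             norm u' \<le> \<kappa> * X / \<delta>\<^sup>2)" if "s \<in> {0..T}" for s
      unfolding u_def using that \<delta> by (intro \<kappa>(2) f X) auto
    have u_le: "norm (u s) \<le> \<kappa> * X / \<delta>" if "s \<in> {0..T}" for s
      using bound[OF that] by simp
    have q: "(q has_vector_derivative p s) (at s within {0..T})" if "s \<in> {0..T}" for s
      using so that by (auto simp: second_order_solution_def intro: has_vector_derivative_within_subset)
    have "\<exists>p'. (p has_vector_derivative p') (at s within {0..T}) \<and>
        \<mu> *\<^sub>R p' = b (q s) + A (q s) *v p s + \<sigma> (q s) *v u s" if "s \<in> {0..T}" for s
      using so that by (fastforce simp: second_order_solution_def u_def
          intro: has_vector_derivative_within_subset)
    then obtain p' where p': "\<And>s. s \<in> {0..T} \<Longrightarrow> (p has_vector_derivative p' s) (at s within {0..T})"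
      "\<And>s. s \<in> {0..T} \<Longrightarrow> \<mu> *\<^sub>R p' s = b (q s) + A (q s) *v p s + \<sigma> (q s) *v u s"
      by metis
    have "\<exists>z'. ((\<lambda>t. F (q t) (u t)) has_vector_derivative z') (at s within {0..T}) \<and>
        norm z' \<le> a * norm (p s) + c" if s: "s \<in> {0..T}" for s
    proof -
      obtain u' where u': "(u has_vector_derivative u') (at s within {0..})" "norm u' \<le> \<kappa> * X / \<delta>\<^sup>2"
        using bound[OF s] by blast
      have "(u has_vector_derivative u') (at s within {0..T})"
        using u'(1) by (rule has_vector_derivative_within_subset) auto
      from K(4)[OF q[OF s] this] obtain z' where
        z': "((\<lambda>t. F (q t) (u t)) has_vector_derivative z') (at s within {0..T})"
          "norm z' \<le> K * (1 + norm (u s)) * norm (p s) + K * norm u'" by blast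
      note z'(2)
      also have "K * (1 + norm (u s)) * norm (p s) + K * norm u' \<le> a * norm (p s) + c"
        unfolding a_def c_def using K(1) u'(2) u_le[OF s]
        by (intro add_mono mult_left_mono mult_right_mono) auto
      finally show ?thesis using z'(1) by blast
    qed
    then obtain z' where z': "\<And>s. s \<in> {0..T} \<Longrightarrow> ((\<lambda>t. F (q t) (u t)) has_vector_derivative z' s) (at s within {0..T})"
      "\<And>s. s \<in> {0..T} \<Longrightarrow> norm (z' s) \<le> a * norm (p s) + c"
      by metis
    have ql: "(ql has_vector_derivative F (ql s) (u s)) (at s within {0..T})" if "s \<in> {0..T}" for s
    proof -
      have ne: "\<alpha> (ql s) \<noteq> 0" using \<alpha>_pos[of "ql s"] by simp
      have "(ql has_vector_derivative - (matrix_inv (A (ql s)) *v b (ql s))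
          - matrix_inv (A (ql s)) *v (\<sigma> (ql s) *v u s)) (at s within {0..})"
        using fo that by (simp add: first_order_solution_def u_def)
      then have "(ql has_vector_derivative F (ql s) (u s)) (at s within {0..})"
        unfolding F_def h_def H_def \<beta>_def first_order_field_eq[OF A ne] .
      then show ?thesis by (rule has_vector_derivative_within_subset) auto
    qed
    have newton: "(\<mu> * \<beta> (q s)) *\<^sub>R p' s = A0 *v (p s - F (q s) (u s))" if "s \<in> {0..T}" for s
    proof -
      have "(\<mu> * \<beta> (q s)) *\<^sub>R p' s = \<beta> (q s) *\<^sub>R (\<mu> *\<^sub>R p' s)" by (simp add: mult.commute)
      also have "\<dots> = h (q s) + A0 *v p s + H (q s) *v u s"
        unfolding p'(2)[OF that] A h_def H_def scaleR_add_right scaleR_matrix_vector_assoc[symmetric]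
        using \<alpha>_pos[of "q s"] by (simp add: \<beta>_def)
      also have "\<dots> = A0 *v (p s - F (q s) (u s))"
        unfolding F_def matrix_vector_mult_diff_distrib A0_mult_vec by simp
      finally show ?thesis .
    qed
    \<comment> \<open>All rates are at most multiples of \<open>(1 + X) / \<delta>\<close> or of its square.\<close>
    have g: "X / \<delta> \<le> (1 + X) / \<delta>" "1 / \<delta> \<le> (1 + X) / \<delta>" "1 \<le> (1 + X) / \<delta>"
      using \<delta> X0 by (auto simp: divide_simps)
    define y where "y = (1 + T) * (1 + X) / \<delta>"
    have gy: "(1 + X) / \<delta> \<le> y"
      using g(3) T mult_right_mono[of 1 "1 + T" "(1 + X) / \<delta>"] by (simp add: y_def)
    have L: "0 \<le> L" "K * \<kappa> \<le> L" "1 \<le> L"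
      using K(1) \<kappa>(1) by (auto simp: L_def algebra_simps)
    have a0: "0 \<le> a" using K(1) \<kappa>(1) X0 \<delta> by (simp add: a_def)
    have c0: "0 \<le> c" using K(1) \<kappa>(1) X0 by (simp add: c_def)
    have a1: "a + 1 \<le> L * ((1 + X) / \<delta>)"
    proof -
      have "K * (1 + \<kappa> * (X / \<delta>)) \<le> K * ((1 + X) / \<delta> + \<kappa> * ((1 + X) / \<delta>))"
        using K(1) \<kappa>(1) g by (intro mult_left_mono add_mono) auto
      moreover have "K * (r + \<kappa> * r) + r = L * r" for r by (simp add: L_def algebra_simps)
      moreover have "a = K * (1 + \<kappa> * (X / \<delta>))" by (simp add: a_def)
      ultimately show ?thesis using g(3) by (metis add_mono)
    qed
    have aL: "a \<le> L * y"
      using a1 mult_left_mono[OF gy L(1)] by linarith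
    have aT: "(a + 1) * T \<le> L * y"
    proof -
      have "(a + 1) * T \<le> (L * ((1 + X) / \<delta>)) * (1 + T)"
        using a1 a0 T L g(3) by (intro mult_mono) auto
      then show ?thesis by (simp add: y_def mult_ac)
    qed
    have cL: "c \<le> (L * y)\<^sup>2"
    proof -
      have "0 \<le> y" using g(3) gy by linarith
      have "c = (K * \<kappa>) * ((X / \<delta>) * (1 / \<delta>))" by (simp add: c_def power2_eq_square)
      also have "\<dots> \<le> L * (y * y)"
        using g gy K(1) \<kappa>(1) X0 \<delta> L \<open>0 \<le> y\<close> by (intro mult_mono) auto
      also have "\<dots> \<le> (L * L) * (y * y)"
        using L by (intro mult_right_mono) (auto simp: mult_le_cancel_left1)
      finally show ?thesis by (simp add: power2_eq_square mult_ac)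
    qed
    have "norm (q t - ql t) \<le> \<mu> * (K\<beta> * (exp ((a + 1) * T) * (norm (p 0) + a + a\<^sup>2 + c) + a) *
        (exp ((a + 1) * T) * (1 + a + (exp ((a + 1) * T) * (norm (p 0) + a + a\<^sup>2 + c) + a)) + 1))"
    proof (rule magnetic_relaxation_estimate[where J = "(*v) A0" and z = "\<lambda>t. F (q t) (u t)"
          and zl = "\<lambda>t. F (ql t) (u t)" and \<beta> = "\<lambda>t. \<beta> (q t)" and \<beta>' = "\<lambda>t. \<beta>' (q t) (p t)",
          OF matrix_vector_mul_bounded_linear A0_mult_vec \<mu> q p'(1) newton ql _ z'(1) _ z'(2) _ _ _ _ a0 c0 t])
      show "q 0 = ql 0" using so fo by (simp add: second_order_solution_def first_order_solution_def)
      fix s assume s: "s \<in> {0..T}"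
      have u1: "K * (1 + norm (u s)) \<le> a"
        unfolding a_def using u_le[OF s] K(1) by (intro mult_left_mono) auto
      then show "norm (F (q s) (u s)) \<le> a" using K(2) order_trans by blast
      show "norm (F (q s) (u s) - F (ql s) (u s)) \<le> a * norm (q s - ql s)"
        using K(3) mult_right_mono[OF u1] order_trans norm_ge_zero by meson
      show "((\<lambda>t. \<beta> (q t)) has_vector_derivative \<beta>' (q s) (p s)) (at s within {0..T})"
        by (rule has_derivative_comp_has_vector_derivative[OF \<beta>'(2) q[OF s]])
      show "0 < \<beta> (q s) \<and> \<beta> (q s) \<le> K\<beta>"
        using \<alpha>_pos[of "q s"] \<beta>'(3)[of "q s"] by (simp add: \<beta>_def)
      show "\<bar>\<beta>' (q s) (p s)\<bar> \<le> K\<beta> * norm (p s)" using \<beta>'(4) by simp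
    qed
    also have "\<dots> \<le> \<mu> * (K\<beta> * (norm (p 0) + 7)\<^sup>2 * exp (7 * L * y))"
      using \<mu> \<beta>'(1)
      by (intro mult_left_mono relaxation_constant_le_exp T a0 aL c0 cL aT) auto
    also have "\<dots> = C * exp (7 * L * ((1 + T) * (1 + X) / \<delta>)) * \<mu>"
      using so by (simp add: C_def y_def second_order_solution_def)
    finally show "norm (q t - ql t) \<le> C * exp (7 * L * ((1 + T) * (1 + X) / \<delta>)) * \<mu>" .
  qed
qed

section \<open>Measurability of the solutions\<close>

primrec euler :: "(real \<Rightarrow> 'a \<Rightarrow> 'a) \<Rightarrow> 'a \<Rightarrow> real \<Rightarrow> nat \<Rightarrow> 'a::real_vector" where
  "euler G x0 h 0 = x0"
| "euler G x0 h (Suc k) = euler G x0 h k + h *\<^sub>R G (h * real k) (euler G x0 h k)"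

text \<open>The Lipschitz bound is required only in a tube of radius \<open>1\<close> around the solution, since the field
  of the second-order equation is not globally Lipschitz.  The local error of a step is \<open>o(h)\<close> by
  uniform continuity of the velocity, and the discrete Gronwall lemma adds these errors up.\<close>

lemma euler_tendsto:
  fixes x :: "real \<Rightarrow> 'a::real_normed_vector"
  assumes T: "0 \<le> T"
    and sol: "\<And>t. t \<in> {0..T} \<Longrightarrow> (x has_vector_derivative G t (x t)) (at t within {0..T})"
    and cont: "continuous_on {0..T} (\<lambda>t. G t (x t))"
    and L: "0 \<le> L"
    and lip: "\<And>t y. t \<in> {0..T} \<Longrightarrow> norm (y - x t) \<le> 1 \<Longrightarrow> norm (G t y - G t (x t)) \<le> L * norm (y - x t)"
  shows "(\<lambda>n. euler G (x 0) (T / real n) n) \<longlonglongrightarrow> x T"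
proof (rule LIMSEQ_I)
  fix r :: real assume "0 < r"
  define \<epsilon> where "\<epsilon> = min r 1"
  have \<epsilon>: "0 < \<epsilon>" "\<epsilon> \<le> 1" "\<epsilon> \<le> r" using \<open>0 < r\<close> by (auto simp: \<epsilon>_def)
  define \<eta> where "\<eta> = \<epsilon> / (2 * (1 + T) * exp (L * T))"
  have \<eta>: "0 < \<eta>" using \<epsilon> T by (simp add: \<eta>_def)
  have small: "T * \<eta> * exp (L * T) < \<epsilon>"
  proof -
    have "T * \<eta> * exp (L * T) = \<epsilon> * (T / (2 * (1 + T)))"
      by (simp add: \<eta>_def)
    also have "\<dots> < \<epsilon> * 1"
      using \<epsilon> T by (intro mult_strict_left_mono) (auto simp: divide_simps)
    finally show ?thesis by simp
  qed
  have "uniformly_continuous_on {0..T} (\<lambda>t. G t (x t))"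
    by (rule compact_uniformly_continuous[OF cont]) simp
  then obtain d where d: "0 < d"
    "\<And>s t. s \<in> {0..T} \<Longrightarrow> t \<in> {0..T} \<Longrightarrow> dist s t < d \<Longrightarrow> dist (G s (x s)) (G t (x t)) < \<eta>"
    using \<eta> unfolding uniformly_continuous_on_def by metis
  obtain N :: nat where N: "real N > T / d" using reals_Archimedean2 by blast
  have "norm (euler G (x 0) (T / real n) n - x T) < r" if n: "Suc N \<le> n" for n
  proof -
    define h where "h = T / real n"
    have n0: "real n > 0" "real N < real n" using n by auto
    have h: "0 \<le> h" "h * real n = T" using T n0 by (auto simp: h_def)
    have hd: "h < d"
      using N n0 d(1) T unfolding h_def
      by (smt (verit, best) divide_less_eq mult.commute)
    have grid: "h * real k \<in> {0..T}" if "k \<le> n" for k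
      using h that by (auto simp: h(2)[symmetric] intro!: mult_left_mono)
    have consistent: "norm (x (h * real (Suc k)) - x (h * real k) - h *\<^sub>R G (h * real k) (x (h * real k))) \<le> h * \<eta>"
      if "k < n" for k
    proof -
      have len: "h * real (Suc k) - h * real k = h" by (simp add: algebra_simps)
      have "norm (x (h * real (Suc k)) - x (h * real k)
            - (h * real (Suc k) - h * real k) *\<^sub>R G (h * real k) (x (h * real k)))
          \<le> norm (h * real (Suc k) - h * real k) * \<eta>"
      proof (rule vector_differentiable_bound_linearization)
        have seg: "closed_segment (h * real k) (h * real (Suc k)) = {h * real k..h * real (Suc k)}"
          using h by (simp add: closed_segment_eq_real_ivl mult_left_mono)
        have sub: "{h * real k..h * real (Suc k)} \<subseteq> {0..T}"
          using grid[of k] grid[of "Suc k"] that by auto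
        show "closed_segment (h * real k) (h * real (Suc k)) \<subseteq> {h * real k..h * real (Suc k)}"
          by (rule eq_refl[OF seg])
        show "h * real k \<in> {h * real k..h * real (Suc k)}"
          using h by (auto intro: mult_left_mono)
        fix t assume t: "t \<in> {h * real k..h * real (Suc k)}"
        show "(x has_vector_derivative G t (x t)) (at t within {h * real k..h * real (Suc k)})"
          using sol sub t by (blast intro: has_vector_derivative_within_subset)
        have "dist t (h * real k) < d"
          using t hd len by (auto simp: dist_real_def)
        then show "norm (G t (x t) - G (h * real k) (x (h * real k))) \<le> \<eta>"
          using d(2)[of t "h * real k"] grid[of k] sub t that by (auto simp: dist_norm)
      qed
      then show ?thesis using h unfolding len by simp
    qed
    \<comment> \<open>As long as this bound is below \<open>1\<close>, the scheme stays in the tube in which the Lipschitz bound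
      is available, so that the induction maintains its own hypothesis.\<close>
    have err: "norm (euler G (x 0) h k - x (h * real k)) \<le> (h * real k) * \<eta> * exp (L * (h * real k))"
      if "k \<le> n" for k
      using that
    proof (induction k)
      case 0
      then show ?case by simp
    next
      case (Suc k)
      define e where "e = norm (euler G (x 0) h k - x (h * real k))"
      define B where "B = (h * real k) * \<eta> * exp (L * (h * real k))"
      have e: "e \<le> B" using Suc by (simp add: e_def B_def)
      also have "B \<le> T * \<eta> * exp (L * T)"
        unfolding B_def using grid[of k] Suc.prems T L \<eta>
        by (intro mult_mono) (auto intro: mult_left_mono)
      also have "\<dots> \<le> 1" using small \<epsilon> by linarith
      finally have tube: "e \<le> 1" .
      have "euler G (x 0) h (Suc k) - x (h * real (Suc k))
          = (euler G (x 0) h k - x (h * real k))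
            + h *\<^sub>R (G (h * real k) (euler G (x 0) h k) - G (h * real k) (x (h * real k)))
            - (x (h * real (Suc k)) - x (h * real k) - h *\<^sub>R G (h * real k) (x (h * real k)))"
        by (simp add: algebra_simps)
      also have "norm \<dots> \<le> (e + h * (L * e)) + h * \<eta>"
      proof -
        have three: "norm (v1 + v2 - v3) \<le> (r1 + r2) + r3"
          if "norm v1 \<le> r1" "norm v2 \<le> r2" "norm v3 \<le> r3" for v1 v2 v3 :: 'a and r1 r2 r3
          using norm_triangle_ineq4[of "v1 + v2" v3] norm_triangle_ineq[of v1 v2] that by linarith
        have "norm (h *\<^sub>R (G (h * real k) (euler G (x 0) h k) - G (h * real k) (x (h * real k))))
            \<le> h * (L * e)"
          using lip[of "h * real k"] grid[of k] Suc.prems tube h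
          by (simp add: e_def mult_left_mono)
        then show ?thesis
          using Suc.prems by (intro three consistent) (auto simp: e_def)
      qed
      also have "\<dots> \<le> B * exp (L * h) + h * \<eta>"
      proof -
        have "e + h * (L * e) = e * (1 + L * h)" by (simp add: algebra_simps)
        also have "\<dots> \<le> B * exp (L * h)"
          using e h L \<eta> by (intro mult_mono exp_ge_add_one_self) (auto simp: B_def)
        finally show ?thesis by simp
      qed
      also have "\<dots> \<le> (h * real k) * \<eta> * exp (L * (h * real (Suc k))) + h * \<eta> * exp (L * (h * real (Suc k)))"
      proof (rule add_mono)
        have "exp (L * (h * real k)) * exp (L * h) = exp (L * (h * real (Suc k)))"
          by (simp add: exp_add[symmetric] algebra_simps)
        then show "B * exp (L * h) \<le> (h * real k) * \<eta> * exp (L * (h * real (Suc k)))"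
          by (simp add: B_def mult.assoc)
        have "1 \<le> exp (L * (h * real (Suc k)))" using L h by simp
        then show "h * \<eta> \<le> h * \<eta> * exp (L * (h * real (Suc k)))"
          using h \<eta> mult_left_mono[of 1 "exp (L * (h * real (Suc k)))" "h * \<eta>"] by simp
      qed
      also have "\<dots> = (h * real (Suc k)) * \<eta> * exp (L * (h * real (Suc k)))"
        by (simp add: algebra_simps)
      finally show ?case .
    qed
    have "norm (euler G (x 0) h n - x T) \<le> T * \<eta> * exp (L * T)"
      using err[of n] by (simp add: h(2))
    then show ?thesis using small \<epsilon> by (simp add: h_def)
  qed
  then show "\<exists>no. \<forall>n\<ge>no. norm (euler G (x 0) (T / real n) n - x T) < r" by blast
qed

text \<open>Solutions that are chosen separately for each \<open>\<omega>\<close> are nevertheless measurable in \<open>\<omega>\<close>: they are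
  limits of Euler schemes, and a step of the scheme is a continuous function of the previous value
  and of the driving signal at a grid time.\<close>

lemma borel_measurable_ode_solution:
  fixes F :: "'a::euclidean_space \<Rightarrow> 'b::euclidean_space \<Rightarrow> 'a"
    and u :: "real \<Rightarrow> 'w \<Rightarrow> 'b" and x :: "real \<Rightarrow> 'w \<Rightarrow> 'a"
  assumes T: "0 \<le> T"
    and F: "continuous_on UNIV (\<lambda>z. F (fst z) (snd z))"
    and lip: "\<And>R. \<exists>L. \<forall>x y v. norm x \<le> R \<longrightarrow> norm y \<le> R \<longrightarrow> norm v \<le> R \<longrightarrow>
       norm (F x v - F y v) \<le> L * norm (x - y)"
    and u_meas: "\<And>t. t \<in> {0..T} \<Longrightarrow> u t \<in> borel_measurable M"
    and u_cont: "\<And>\<omega>. \<omega> \<in> space M \<Longrightarrow> continuous_on {0..T} (\<lambda>t. u t \<omega>)"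
    and start: "\<And>\<omega>. \<omega> \<in> space M \<Longrightarrow> x 0 \<omega> = x0"
    and sol: "\<And>\<omega> t. \<omega> \<in> space M \<Longrightarrow> t \<in> {0..T} \<Longrightarrow>
       ((\<lambda>t. x t \<omega>) has_vector_derivative F (x t \<omega>) (u t \<omega>)) (at t within {0..T})"
  shows "x T \<in> borel_measurable M"
proof (rule borel_measurable_LIMSEQ_metric)
  have F_meas: "(\<lambda>\<omega>. F (f \<omega>) (g \<omega>)) \<in> borel_measurable M"
    if "f \<in> borel_measurable M" "g \<in> borel_measurable M" for f g
    using measurable_compose[OF borel_measurable_Pair[OF that] borel_measurable_continuous_onI[OF F]]
    by simp
  show "(\<lambda>\<omega>. euler (\<lambda>t y. F y (u t \<omega>)) x0 (T / real n) n) \<in> borel_measurable M" for n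
  proof -
    have "(\<lambda>\<omega>. euler (\<lambda>t y. F y (u t \<omega>)) x0 (T / real n) k) \<in> borel_measurable M" if "k \<le> n" for k
      using that
    proof (induction k)
      case (Suc k)
      have "T / real n * real k \<in> {0..T}"
        using T Suc.prems by (auto simp: divide_simps intro!: mult_left_mono)
      then show ?case
        using Suc by (auto intro!: borel_measurable_add borel_measurable_scaleR F_meas u_meas)
    qed simp
    then show ?thesis by simp
  qed
  fix \<omega> assume \<omega>: "\<omega> \<in> space M"
  have x_cont: "continuous_on {0..T} (\<lambda>t. x t \<omega>)"
    using sol[OF \<omega>] by (rule continuous_on_vector_derivative)
  have "compact ((\<lambda>t. x t \<omega>) ` {0..T})" "compact ((\<lambda>t. u t \<omega>) ` {0..T})"
    by (intro compact_continuous_image x_cont u_cont \<omega> compact_Icc)+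
  then obtain R1 R2 where R: "\<And>t. t \<in> {0..T} \<Longrightarrow> norm (x t \<omega>) \<le> R1" "\<And>t. t \<in> {0..T} \<Longrightarrow> norm (u t \<omega>) \<le> R2"
    using compact_imp_bounded bounded_iff by (metis imageI)
  obtain L where L: "\<And>y y' v. norm y \<le> max (R1 + 1) R2 \<Longrightarrow> norm y' \<le> max (R1 + 1) R2 \<Longrightarrow>
      norm v \<le> max (R1 + 1) R2 \<Longrightarrow> norm (F y v - F y' v) \<le> L * norm (y - y')"
    using lip by meson
  have "(\<lambda>n. euler (\<lambda>t y. F y (u t \<omega>)) (x 0 \<omega>) (T / real n) n) \<longlonglongrightarrow> x T \<omega>"
  proof (rule euler_tendsto[where x = "\<lambda>t. x t \<omega>" and G = "\<lambda>t y. F y (u t \<omega>)" and L = "max L 0",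
        OF T sol[OF \<omega>]])
    show "continuous_on {0..T} (\<lambda>t. F (x t \<omega>) (u t \<omega>))"
      using continuous_on_compose2[OF F continuous_on_Pair[OF x_cont u_cont[OF \<omega>]]] by simp
    show "norm (F y (u t \<omega>) - F (x t \<omega>) (u t \<omega>)) \<le> max L 0 * norm (y - x t \<omega>)"
      if t: "t \<in> {0..T}" and y: "norm (y - x t \<omega>) \<le> 1" for t y
    proof -
      have "norm y \<le> R1 + 1"
        using norm_triangle_ineq[of "y - x t \<omega>" "x t \<omega>"] R(1)[OF t] y by simp
      then have "norm (F y (u t \<omega>) - F (x t \<omega>) (u t \<omega>)) \<le> L * norm (y - x t \<omega>)"
        using R(1)[OF t] R(2)[OF t] by (intro L) auto
      also have "\<dots> \<le> max L 0 * norm (y - x t \<omega>)"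
        by (intro mult_right_mono) auto
      finally show ?thesis .
    qed
  qed auto
  then show "(\<lambda>n. euler (\<lambda>t y. F y (u t \<omega>)) x0 (T / real n) n) \<longlonglongrightarrow> x T \<omega>"
    by (simp add: start[OF \<omega>])
qed

lemma borel_measurable_first_order_solution:
  assumes b: "bounded_with_derivative b" and \<sigma>: "bounded_with_derivative \<sigma>"
    and \<alpha>: "bounded_with_derivative \<alpha>" and \<alpha>0: "0 < \<alpha>0" "\<And>x. \<alpha>0 \<le> \<alpha> x"
    and A: "\<And>x. A x = \<alpha> x *\<^sub>R A0" and T: "0 \<le> T"
    and u_meas: "\<And>t. t \<in> {0..T} \<Longrightarrow> u t \<in> borel_measurable M"
    and u_cont: "\<And>\<omega>. \<omega> \<in> space M \<Longrightarrow> continuous_on {0..T} (\<lambda>t. u t \<omega>)"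
    and sol: "\<And>\<omega>. \<omega> \<in> space M \<Longrightarrow> first_order_solution b A \<sigma> (\<lambda>t. u t \<omega>) q0 (\<lambda>t. q t \<omega>)"
  shows "q T \<in> borel_measurable M"
proof -
  define h where "h x = inverse (\<alpha> x) *\<^sub>R b x" for x
  define H where "H x = inverse (\<alpha> x) *\<^sub>R \<sigma> x" for x
  define F where "F x v = A0 *v (h x + H x *v v)" for x v
  have \<alpha>_ne: "\<alpha> x \<noteq> 0" for x using \<alpha>0(1) \<alpha>0(2)[of x] by linarith
  note bwd = bounded_with_derivative_bilinear[OF bounded_bilinear_scaleR
      bounded_with_derivative_inverse[OF \<alpha> \<alpha>0]]
  have h: "bounded_with_derivative h" and H: "bounded_with_derivative H"
    unfolding h_def H_def by (rule bwd[OF b], rule bwd[OF \<sigma>])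
  obtain K where K: "1 \<le> K"
    "\<And>x y v. norm (F x v - F y v) \<le> K * (1 + norm v) * norm (x - y)"
    unfolding F_def by (rule driven_field_estimates[OF h H, of A0]) blast
  show ?thesis
  proof (rule borel_measurable_ode_solution[OF T _ _ u_meas u_cont])
    show "continuous_on UNIV (\<lambda>z. F (fst z) (snd z))"
      unfolding F_def
      by (intro continuous_on_matrix_vector continuous_intros
          continuous_on_compose2[OF bounded_with_derivative_continuous[OF h]]
          continuous_on_compose2[OF bounded_with_derivative_continuous[OF H]]) auto
    show "\<exists>L. \<forall>x y v. norm x \<le> R \<longrightarrow> norm y \<le> R \<longrightarrow> norm v \<le> R \<longrightarrow>
       norm (F x v - F y v) \<le> L * norm (x - y)" for R
    proof (intro exI allI impI)
      fix x y v :: "real ^ 2" assume "norm v \<le> R"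
      then have "K * (1 + norm v) * norm (x - y) \<le> K * (1 + R) * norm (x - y)"
        using K(1) by (intro mult_right_mono mult_left_mono) auto
      with K(2) show "norm (F x v - F y v) \<le> K * (1 + R) * norm (x - y)"
        by (rule order_trans)
    qed
    show "q 0 \<omega> = q0" if "\<omega> \<in> space M" for \<omega>
      using sol[OF that] by (simp add: first_order_solution_def)
    show "((\<lambda>t. q t \<omega>) has_vector_derivative F (q t \<omega>) (u t \<omega>)) (at t within {0..T})"
      if "\<omega> \<in> space M" "t \<in> {0..T}" for \<omega> t
    proof -
      have "((\<lambda>t. q t \<omega>) has_vector_derivative - (matrix_inv (A (q t \<omega>)) *v b (q t \<omega>))
          - matrix_inv (A (q t \<omega>)) *v (\<sigma> (q t \<omega>) *v u t \<omega>)) (at t within {0..})"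
        using sol[OF that(1)] that(2) by (simp add: first_order_solution_def)
      then have "((\<lambda>t. q t \<omega>) has_vector_derivative F (q t \<omega>) (u t \<omega>)) (at t within {0..})"
        unfolding F_def h_def H_def first_order_field_eq[OF A \<alpha>_ne] .
      then show ?thesis by (rule has_vector_derivative_within_subset) auto
    qed
  qed
qed

text \<open>Position and momentum together solve a first-order equation in phase space.\<close>

lemma borel_measurable_second_order_solution:
  assumes b: "bounded_with_derivative b" and \<sigma>: "bounded_with_derivative \<sigma>"
    and \<alpha>: "bounded_with_derivative \<alpha>"
    and A: "\<And>x. A x = \<alpha> x *\<^sub>R A0" and \<mu>: "0 < \<mu>" and T: "0 \<le> T"
    and u_meas: "\<And>t. t \<in> {0..T} \<Longrightarrow> u t \<in> borel_measurable M"
    and u_cont: "\<And>\<omega>. \<omega> \<in> space M \<Longrightarrow> continuous_on {0..T} (\<lambda>t. u t \<omega>)"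
    and sol: "\<And>\<omega>. \<omega> \<in> space M \<Longrightarrow>
      second_order_solution b A \<sigma> \<mu> (\<lambda>t. u t \<omega>) q0 p0 (\<lambda>t. q t \<omega>) (\<lambda>t. p t \<omega>)"
  shows "q T \<in> borel_measurable M"
proof -
  define G where "G x v = mat 1 *v (b x + \<sigma> x *v v)" for x v
  \<comment> \<open>The phase-space field is only locally Lipschitz, because the magnetic term is a product of
    position and momentum.\<close>
  define F where "F z v = (snd z, inverse \<mu> *\<^sub>R (G (fst z) v + \<alpha> (fst z) *\<^sub>R (A0 *v snd z)))" for z v
  obtain K where K: "1 \<le> K"
    "\<And>x y v. norm (G x v - G y v) \<le> K * (1 + norm v) * norm (x - y)"
    unfolding G_def by (rule driven_field_estimates[OF b \<sigma>, of "mat 1"]) blast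
  obtain K' where K': "1 \<le> K'" "\<And>x. norm (\<alpha> x) \<le> K'" "\<And>x y. norm (\<alpha> x - \<alpha> y) \<le> K' * norm (x - y)"
    using \<alpha> by (rule bounded_with_derivativeE) blast
  have "(\<lambda>\<omega>. (q T \<omega>, p T \<omega>)) \<in> borel_measurable M"
  proof (rule borel_measurable_ode_solution[where x = "\<lambda>t \<omega>. (q t \<omega>, p t \<omega>)", OF T _ _ u_meas u_cont])
    show "continuous_on UNIV (\<lambda>z. F (fst z) (snd z))"
      unfolding F_def G_def
      by (intro continuous_on_matrix_vector continuous_intros
          continuous_on_compose2[OF bounded_with_derivative_continuous[OF b]]
          continuous_on_compose2[OF bounded_with_derivative_continuous[OF \<sigma>]]
          continuous_on_compose2[OF bounded_with_derivative_continuous[OF \<alpha>]]) auto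
    show "\<exists>L. \<forall>x y v. norm x \<le> R \<longrightarrow> norm y \<le> R \<longrightarrow> norm v \<le> R \<longrightarrow>
       norm (F x v - F y v) \<le> L * norm (x - y)" for R
    proof (intro exI allI impI)
      fix x y :: "(real ^ 2) \<times> (real ^ 2)" and v :: "real ^ 2"
      assume R: "norm x \<le> R" "norm y \<le> R" "norm v \<le> R"
      have fst: "norm (fst x - fst y) \<le> norm (x - y)" and snd: "norm (snd x - snd y) \<le> norm (x - y)"
        using norm_fst_le[of "fst (x - y)" "snd (x - y)"] norm_snd_le[of "snd (x - y)" "fst (x - y)"]
        by (simp_all add: minus_prod_def)
      have R0: "0 \<le> R" using R(1) norm_ge_zero order_trans by blast
      have sndy: "norm (snd y) \<le> R"
        using norm_snd_le[of "snd y" "fst y"] R(2) by simp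
      have 1: "norm (G (fst x) v - G (fst y) v) \<le> K * (1 + R) * norm (x - y)"
      proof -
        have "norm (G (fst x) v - G (fst y) v) \<le> K * (1 + norm v) * norm (fst x - fst y)" by (rule K(2))
        also have "\<dots> \<le> K * (1 + R) * norm (x - y)"
          using K(1) R R0 fst by (intro mult_mono) auto
        finally show ?thesis .
      qed
      have 2: "norm (\<alpha> (fst x) *\<^sub>R (A0 *v snd x) - \<alpha> (fst y) *\<^sub>R (A0 *v snd y)) \<le> (K' + K' * R) * norm (x - y)"
      proof -
        have "\<alpha> (fst x) *\<^sub>R (A0 *v snd x) - \<alpha> (fst y) *\<^sub>R (A0 *v snd y)
            = \<alpha> (fst x) *\<^sub>R (A0 *v (snd x - snd y)) + (\<alpha> (fst x) - \<alpha> (fst y)) *\<^sub>R (A0 *v snd y)"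
          by (simp add: matrix_vector_mult_diff_distrib scaleR_diff_right scaleR_diff_left)
        also have "norm \<dots> \<le> K' * norm (x - y) + (K' * norm (x - y)) * R"
        proof (rule norm_triangle_mono)
          show "norm (\<alpha> (fst x) *\<^sub>R (A0 *v (snd x - snd y))) \<le> K' * norm (x - y)"
            using K'(1) K'(2)[of "fst x"] snd unfolding norm_scaleR A0_mult_vec(1)
            by (intro mult_mono) auto
          have "norm (\<alpha> (fst x) - \<alpha> (fst y)) \<le> K' * norm (x - y)"
            using K'(3)[of "fst x" "fst y"] mult_left_mono[OF fst, of K'] K'(1) by linarith
          then show "norm ((\<alpha> (fst x) - \<alpha> (fst y)) *\<^sub>R (A0 *v snd y)) \<le> (K' * norm (x - y)) * R"
            using K'(1) sndy unfolding norm_scaleR A0_mult_vec(1) by (intro mult_mono) auto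
        qed
        finally show ?thesis by (simp add: algebra_simps)
      qed
      have "F x v - F y v = (snd x - snd y, inverse \<mu> *\<^sub>R ((G (fst x) v - G (fst y) v)
          + (\<alpha> (fst x) *\<^sub>R (A0 *v snd x) - \<alpha> (fst y) *\<^sub>R (A0 *v snd y))))"
        by (simp add: F_def algebra_simps)
      also have "norm \<dots> \<le> norm (snd x - snd y) + norm (inverse \<mu> *\<^sub>R ((G (fst x) v - G (fst y) v)
          + (\<alpha> (fst x) *\<^sub>R (A0 *v snd x) - \<alpha> (fst y) *\<^sub>R (A0 *v snd y))))"
        by (rule norm_Pair_le)
      also have "\<dots> \<le> norm (x - y) + inverse \<mu> * (K * (1 + R) * norm (x - y) + (K' + K' * R) * norm (x - y))"
        using \<mu> by (intro add_mono snd) (auto intro!: divide_right_mono norm_triangle_mono 1 2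
            simp: divide_inverse_commute[symmetric])
      also have "\<dots> = (1 + inverse \<mu> * (K * (1 + R) + (K' + K' * R))) * norm (x - y)"
        by (simp only: distrib_right distrib_left mult_1 mult.assoc)
      finally show "norm (F x v - F y v) \<le> (1 + inverse \<mu> * (K * (1 + R) + (K' + K' * R))) * norm (x - y)" .
    qed
    show "(q 0 \<omega>, p 0 \<omega>) = (q0, p0)" if "\<omega> \<in> space M" for \<omega>
      using sol[OF that] by (simp add: second_order_solution_def)
    show "((\<lambda>t. (q t \<omega>, p t \<omega>)) has_vector_derivative F (q t \<omega>, p t \<omega>) (u t \<omega>)) (at t within {0..T})"
      if \<omega>: "\<omega> \<in> space M" and t: "t \<in> {0..T}" for \<omega> t
    proof -
      obtain p' where q: "((\<lambda>t. q t \<omega>) has_vector_derivative p t \<omega>) (at t within {0..})"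
        and p: "((\<lambda>t. p t \<omega>) has_vector_derivative p') (at t within {0..})"
        and p': "\<mu> *\<^sub>R p' = b (q t \<omega>) + A (q t \<omega>) *v p t \<omega> + \<sigma> (q t \<omega>) *v u t \<omega>"
        using sol[OF \<omega>] t by (fastforce simp: second_order_solution_def)
      have "p' = inverse \<mu> *\<^sub>R (\<mu> *\<^sub>R p')" using \<mu> by simp
      also have "\<mu> *\<^sub>R p' = G (q t \<omega>) (u t \<omega>) + \<alpha> (q t \<omega>) *\<^sub>R (A0 *v p t \<omega>)"
        unfolding p' G_def A by (simp add: scaleR_matrix_vector_assoc)
      finally have "F (q t \<omega>, p t \<omega>) (u t \<omega>) = (p t \<omega>, p')" by (simp add: F_def)
      with has_vector_derivative_Pair[OF q p] show ?thesis
        by (auto intro: has_vector_derivative_within_subset)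
    qed
  qed
  from measurable_compose[OF this, of fst borel] show ?thesis
    by (simp add: borel_measurable_continuous_onI continuous_on_fst)
qed

section \<open>Small-mass limit for the mollified Wiener process\<close>

lemma integral_le_of_nn_integral_le:
  fixes f :: "'a \<Rightarrow> real"
  assumes f: "f \<in> borel_measurable M" "\<And>x. x \<in> space M \<Longrightarrow> 0 \<le> f x"
    and le: "(\<integral>\<^sup>+x. ennreal (f x) \<partial>M) \<le> ennreal B" and B: "0 \<le> B"
  shows "integrable M f" "(\<integral>x. f x \<partial>M) \<le> B"
proof -
  show int: "integrable M f"
    using f le by (intro integrableI_nonneg AE_I2) (auto simp: le_less_trans)
  have "ennreal (\<integral>x. f x \<partial>M) \<le> ennreal B"
    using nn_integral_eq_integral[OF int] f(2) le by simp
  then show "(\<integral>x. f x \<partial>M) \<le> B" using B by (simp add: ennreal_le_iff)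
qed

theorem theorem2p1:
  fixes M :: "'w measure"
    and w :: "real \<Rightarrow> 'w \<Rightarrow> real ^ 2"
    and \<rho> :: "real \<Rightarrow> real"
    and b :: "real ^ 2 \<Rightarrow> real ^ 2"
    and \<sigma> :: "real ^ 2 \<Rightarrow> real ^ 2 ^ 2"
    and \<alpha> :: "real ^ 2 \<Rightarrow> real"
    and \<alpha>0 :: real
    and A :: "real ^ 2 \<Rightarrow> real ^ 2 ^ 2"
    and q0 p0 :: "real ^ 2"
    and q p :: "real \<Rightarrow> real \<Rightarrow> real \<Rightarrow> 'w \<Rightarrow> real ^ 2"
    and q_lim :: "real \<Rightarrow> real \<Rightarrow> 'w \<Rightarrow> real ^ 2"
  assumes wiener: "standard_wiener_process M w"
    and \<rho>: "mollifier \<rho>"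
    and b: "bounded_with_derivative b"
    and \<sigma>: "bounded_with_derivative \<sigma>"
    and \<alpha>: "bounded_with_derivative \<alpha>"
    and \<alpha>0: "(INF x. \<alpha> x) = \<alpha>0" "\<alpha>0 > 0"
    and A: "\<And>x. A x = \<alpha> x *\<^sub>R A0"
    and qp: "\<And>\<mu> \<delta> \<omega>. \<mu> \<in> {0<..1} \<Longrightarrow> \<delta> \<in> {0<..1} \<Longrightarrow> \<omega> \<in> space M \<Longrightarrow>
       second_order_solution b A \<sigma> \<mu> (mollified_velocity \<rho> \<delta> (\<lambda>s. w s \<omega>)) q0 p0
         (\<lambda>t. q \<mu> \<delta> t \<omega>) (\<lambda>t. p \<mu> \<delta> t \<omega>)"
    and q_lim: "\<And>\<delta> \<omega>. \<delta> \<in> {0<..1} \<Longrightarrow> \<omega> \<in> space M \<Longrightarrow>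
       first_order_solution b A \<sigma> (mollified_velocity \<rho> \<delta> (\<lambda>s. w s \<omega>)) q0 (\<lambda>t. q_lim \<delta> t \<omega>)"
  shows "(\<exists>C>0. \<forall>T>0. \<forall>\<mu>\<in>{0<..1}. \<forall>\<delta>\<in>{0<..1}.
            integrable M (\<lambda>\<omega>. SUP t\<in>{0..T}. norm (q \<mu> \<delta> t \<omega> - q_lim \<delta> t \<omega>)) \<and>
            (\<integral>\<omega>. (SUP t\<in>{0..T}. norm (q \<mu> \<delta> t \<omega> - q_lim \<delta> t \<omega>)) \<partial>M)
              \<le> C * (1 + T) powr (11 / 2) * exp (C / \<delta>\<^sup>2 * (1 + T) ^ 3) * \<mu>) \<and>
         (\<forall>T>0. \<forall>\<delta>\<in>{0<..1}.
            ((\<lambda>\<mu>. \<integral>\<omega>. (SUP t\<in>{0..T}. norm (q \<mu> \<delta> t \<omega> - q_lim \<delta> t \<omega>)) \<partial>M) \<longlongrightarrow> 0)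
              (at_right 0))"
proof -
  define D where "D T \<mu> \<delta> \<omega> = (SUP t\<in>{0..T}. norm (q \<mu> \<delta> t \<omega> - q_lim \<delta> t \<omega>))" for T \<mu> \<delta> \<omega>
  have \<alpha>_ge: "\<alpha>0 \<le> \<alpha> x" for x
  proof -
    have "bdd_below (range \<alpha>)"
      using \<alpha> by (simp add: bounded_with_derivative_def bounded_imp_bdd_below)
    then show ?thesis using \<alpha>0(1) cINF_lower[of \<alpha> UNIV x] by simp
  qed
  obtain C L where C: "0 < C" and L: "0 < L" and rate:
    "\<And>f T X \<mu> \<delta> q p ql t. continuous_on {0..} f \<Longrightarrow> (\<And>s. s \<in> {0..T + 1} \<Longrightarrow> norm (f s) \<le> X) \<Longrightarrow>
       0 < \<mu> \<Longrightarrow> 0 < \<delta> \<Longrightarrow> \<delta> \<le> 1 \<Longrightarrow>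
       second_order_solution b A \<sigma> \<mu> (mollified_velocity \<rho> \<delta> f) q0 p0 q p \<Longrightarrow>
       first_order_solution b A \<sigma> (mollified_velocity \<rho> \<delta> f) q0 ql \<Longrightarrow> t \<in> {0..T} \<Longrightarrow>
       norm (q t - ql t) \<le> C * exp (L * ((1 + T) * (1 + X) / \<delta>)) * \<mu>"
    using pathwise_convergence_rate[OF \<rho> b \<sigma> \<alpha> \<alpha>0(2) \<alpha>_ge A, of q0 p0] by metis
  have w_cont: "continuous_on {0..} (\<lambda>s. w s \<omega>)" if "\<omega> \<in> space M" for \<omega>
    using wiener that by (simp add: standard_wiener_process_def)
  have w_meas: "w s \<in> borel_measurable M" if "0 \<le> s" for s
    using wiener that by (simp add: standard_wiener_process_def)
  have diff_cont: "continuous_on {0..T} (\<lambda>t. norm (q \<mu> \<delta> t \<omega> - q_lim \<delta> t \<omega>))"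
    if "\<mu> \<in> {0<..1}" "\<delta> \<in> {0<..1}" "\<omega> \<in> space M" for T \<mu> \<delta> \<omega>
  proof -
    have "continuous_on {0..} (\<lambda>t. q \<mu> \<delta> t \<omega>)" "continuous_on {0..} (\<lambda>t. q_lim \<delta> t \<omega>)"
      using qp[OF that] q_lim[OF that(2,3)]
      unfolding second_order_solution_def first_order_solution_def
      by (auto intro!: continuous_on_vector_derivative)
    then have "continuous_on {0..} (\<lambda>t. norm (q \<mu> \<delta> t \<omega> - q_lim \<delta> t \<omega>))"
      by (intro continuous_intros)
    then show ?thesis by (rule continuous_on_subset) auto
  qed
  have D_nonneg: "0 \<le> D T \<mu> \<delta> \<omega>"
    if "0 \<le> T" "\<mu> \<in> {0<..1}" "\<delta> \<in> {0<..1}" "\<omega> \<in> space M" for T \<mu> \<delta> \<omega>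
  proof -
    have "bdd_above ((\<lambda>t. norm (q \<mu> \<delta> t \<omega> - q_lim \<delta> t \<omega>)) ` {0..T})"
      by (intro bounded_imp_bdd_above compact_imp_bounded compact_continuous_image diff_cont that) auto
    then have "norm (q \<mu> \<delta> 0 \<omega> - q_lim \<delta> 0 \<omega>) \<le> D T \<mu> \<delta> \<omega>"
      unfolding D_def using that(1) by (intro cSUP_upper) auto
    then show ?thesis using norm_ge_zero order_trans by blast
  qed
  have D_meas: "D T \<mu> \<delta> \<in> borel_measurable M"
    if "0 \<le> T" "\<mu> \<in> {0<..1}" "\<delta> \<in> {0<..1}" for T \<mu> \<delta>
  proof -
    have \<mu>: "0 < \<mu>" and \<delta>: "0 < \<delta>" using that by auto
    note u_meas = mollified_wiener_velocity_regular(1)[OF wiener \<rho> \<delta>]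
      and u_cont = mollified_wiener_velocity_regular(2)[OF wiener \<rho> \<delta>]
    have q_meas: "q \<mu> \<delta> t \<in> borel_measurable M" if "0 \<le> t" for t
      by (rule borel_measurable_second_order_solution[OF b \<sigma> \<alpha> A \<mu> that,
            where u = "\<lambda>t \<omega>. mollified_velocity \<rho> \<delta> (\<lambda>s. w s \<omega>) t" and p = "p \<mu> \<delta>"])
        (use u_meas u_cont qp[OF \<open>\<mu> \<in> _\<close> \<open>\<delta> \<in> _\<close>] in auto)
    have ql_meas: "q_lim \<delta> t \<in> borel_measurable M" if "0 \<le> t" for t
      by (rule borel_measurable_first_order_solution[OF b \<sigma> \<alpha> \<alpha>0(2) \<alpha>_ge A that,
            where u = "\<lambda>t \<omega>. mollified_velocity \<rho> \<delta> (\<lambda>s. w s \<omega>) t"])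
        (use u_meas u_cont q_lim[OF \<open>\<delta> \<in> _\<close>] in auto)
    show ?thesis
      unfolding D_def[abs_def]
    proof (rule borel_measurable_SUP_continuous_paths[OF that(1)])
      show "(\<lambda>\<omega>. norm (q \<mu> \<delta> t \<omega> - q_lim \<delta> t \<omega>)) \<in> borel_measurable M" if "t \<in> {0..T}" for t
      proof -
        have [measurable]: "q \<mu> \<delta> t \<in> borel_measurable M" "q_lim \<delta> t \<in> borel_measurable M"
          using that by (auto intro: q_meas ql_meas)
        show ?thesis by measurable
      qed
    qed (intro diff_cont that)
  qed
  define K where "K = max (16 * C) (L + 2 * L\<^sup>2)"
  have K: "0 < K" "16 * C \<le> K" "L + 2 * L\<^sup>2 \<le> K" using C by (auto simp: K_def)
  have main: "integrable M (D T \<mu> \<delta>) \<and>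
      (\<integral>\<omega>. D T \<mu> \<delta> \<omega> \<partial>M) \<le> K * (1 + T) powr (11 / 2) * exp (K / \<delta>\<^sup>2 * (1 + T) ^ 3) * \<mu>"
    if T: "0 < T" and \<mu>: "\<mu> \<in> {0<..1}" and \<delta>: "\<delta> \<in> {0<..1}" for T \<mu> \<delta>
  proof -
    define X where "X \<omega> = (SUP s\<in>{0..T + 1}. norm (w s \<omega>))" for \<omega>
    define c where "c = L * (1 + T) / \<delta>"
    have c: "0 \<le> c" using L T \<delta> by (simp add: c_def)
    have X_cont: "continuous_on {0..T + 1} (\<lambda>s. norm (w s \<omega>))" if "\<omega> \<in> space M" for \<omega>
      by (intro continuous_intros continuous_on_subset[OF w_cont[OF that]]) auto
    have X_meas: "X \<in> borel_measurable M"
      unfolding X_def[abs_def]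
    proof (rule borel_measurable_SUP_continuous_paths)
      show "(\<lambda>\<omega>. norm (w s \<omega>)) \<in> borel_measurable M" if "s \<in> {0..T + 1}" for s
        using w_meas[of s] that by (intro measurable_compose[OF _ borel_measurable_norm]) auto
    qed (use T in \<open>auto intro: X_cont\<close>)
    \<comment> \<open>The exponent is affine in the maximum of the path, with slope \<open>c\<close> of order \<open>(1 + T) / \<delta>\<close>.\<close>
    have D_le: "D T \<mu> \<delta> \<omega> \<le> (C * \<mu> * exp c) * exp (c * X \<omega>)" if \<omega>: "\<omega> \<in> space M" for \<omega>
    proof -
      have w_le: "norm (w s \<omega>) \<le> X \<omega>" if "s \<in> {0..T + 1}" for s
        unfolding X_def
        by (intro cSUP_upper that bounded_imp_bdd_above compact_imp_bounded compact_continuous_image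
            X_cont \<omega>) auto
      have "norm (q \<mu> \<delta> t \<omega> - q_lim \<delta> t \<omega>) \<le> C * exp (L * ((1 + T) * (1 + X \<omega>) / \<delta>)) * \<mu>"
        if "t \<in> {0..T}" for t
        using \<mu> \<delta>
        by (intro rate[OF w_cont[OF \<omega>] w_le _ _ _ qp[OF \<mu> \<delta> \<omega>] q_lim[OF \<delta> \<omega>] that]) auto
      then have "D T \<mu> \<delta> \<omega> \<le> C * exp (L * ((1 + T) * (1 + X \<omega>) / \<delta>)) * \<mu>"
        unfolding D_def using T by (intro cSUP_least) auto
      also have "L * ((1 + T) * (1 + X \<omega>) / \<delta>) = c + c * X \<omega>"
        using \<delta> by (simp add: c_def field_simps)
      finally show ?thesis by (simp add: exp_add mult_ac)
    qed
    define B where "B = (C * \<mu> * exp c) * (16 * exp ((c * 2)\<^sup>2 * (T + 1) / 2))"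
    have pos: "0 \<le> C * \<mu> * exp c" using C \<mu> by simp
    have "(\<integral>\<^sup>+\<omega>. ennreal (D T \<mu> \<delta> \<omega>) \<partial>M)
        \<le> (\<integral>\<^sup>+\<omega>. ennreal (C * \<mu> * exp c) * ennreal (exp (c * X \<omega>)) \<partial>M)"
      using D_le pos by (intro nn_integral_mono) (simp add: ennreal_mult[symmetric] ennreal_leI)
    also have "\<dots> = ennreal (C * \<mu> * exp c) * (\<integral>\<^sup>+\<omega>. ennreal (exp (c * X \<omega>)) \<partial>M)"
      using X_meas by (intro nn_integral_cmult) measurable
    also have "\<dots> \<le> ennreal (C * \<mu> * exp c) * ennreal (16 * exp ((c * 2)\<^sup>2 * (T + 1) / 2))"
      using wiener_exp_sup_moment[OF wiener _ c, of "T + 1"] T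
      by (intro mult_left_mono) (simp_all add: X_def)
    also have "\<dots> = ennreal B"
      unfolding B_def using pos by (simp add: ennreal_mult)
    finally have nn: "(\<integral>\<^sup>+\<omega>. ennreal (D T \<mu> \<delta> \<omega>) \<partial>M) \<le> ennreal B" .
    have "0 \<le> B" using pos by (simp add: B_def)
    note int = integral_le_of_nn_integral_le[OF D_meas[OF less_imp_le[OF T] \<mu> \<delta>]
        D_nonneg[OF less_imp_le[OF T] \<mu> \<delta>] nn this]
    have "B \<le> K * (1 + T) powr (11 / 2) * exp (K / \<delta>\<^sup>2 * (1 + T) ^ 3) * \<mu>"
    proof -
      \<comment> \<open>A slope \<open>c\<close> and a horizon \<open>1 + T\<close> give an exponent of order \<open>c\<^sup>2 (1 + T)\<close>, that is,
        \<open>(1 + T)\<^sup>3 / \<delta>\<^sup>2\<close>.\<close>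
      define Z where "Z = (1 + T) ^ 3 / \<delta>\<^sup>2"
      have "(1 + T) / \<delta> \<le> Z"
      proof -
        have "(1 + T) * \<delta> \<le> (1 + T) ^ 3 * 1"
          using T \<delta> power_increasing[of 1 3 "1 + T"] by (intro mult_mono) auto
        then have "(1 + T) * \<delta> / \<delta>\<^sup>2 \<le> Z"
          unfolding Z_def by (intro divide_right_mono) auto
        then show ?thesis using \<delta> by (simp add: power2_eq_square)
      qed
      then have "c \<le> L * Z" using mult_left_mono[of "(1 + T) / \<delta>" Z L] L by (simp add: c_def)
      moreover have "(c * 2)\<^sup>2 * (T + 1) / 2 = 2 * L\<^sup>2 * Z"
        by (simp add: c_def Z_def power2_eq_square power3_eq_cube add.commute[of T])
      ultimately have "c + (c * 2)\<^sup>2 * (T + 1) / 2 \<le> (L + 2 * L\<^sup>2) * Z"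
        by (simp add: distrib_right)
      also have "\<dots> \<le> K * Z"
        using K T by (intro mult_right_mono) (auto simp: Z_def)
      finally have e: "exp c * exp ((c * 2)\<^sup>2 * (T + 1) / 2) \<le> exp (K / \<delta>\<^sup>2 * (1 + T) ^ 3)"
        by (simp add: exp_add[symmetric] Z_def)
      have "B = (16 * C) * 1 * (exp c * exp ((c * 2)\<^sup>2 * (T + 1) / 2)) * \<mu>"
        by (simp add: B_def mult_ac)
      also have "\<dots> \<le> K * (1 + T) powr (11 / 2) * exp (K / \<delta>\<^sup>2 * (1 + T) ^ 3) * \<mu>"
        using K C T \<mu> e by (intro mult_mono ge_one_powr_ge_zero) auto
      finally show ?thesis .
    qed
    with int show ?thesis by auto
  qed
  have lim: "((\<lambda>\<mu>. \<integral>\<omega>. D T \<mu> \<delta> \<omega> \<partial>M) \<longlongrightarrow> 0) (at_right 0)"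
    if T: "0 < T" and \<delta>: "\<delta> \<in> {0<..1}" for T \<delta>
  proof (rule tendsto_sandwich)
    define R where "R = K * (1 + T) powr (11 / 2) * exp (K / \<delta>\<^sup>2 * (1 + T) ^ 3)"
    have small: "\<forall>\<^sub>F \<mu> in at_right 0. \<mu> \<in> {0<..<1 :: real}"
      by (rule eventually_at_right_real) simp
    then show "\<forall>\<^sub>F \<mu> in at_right 0. 0 \<le> (\<integral>\<omega>. D T \<mu> \<delta> \<omega> \<partial>M)"
      by eventually_elim (use T \<delta> in \<open>auto intro!: Bochner_Integration.integral_nonneg_AE AE_I2 D_nonneg\<close>)
    show "\<forall>\<^sub>F \<mu> in at_right 0. (\<integral>\<omega>. D T \<mu> \<delta> \<omega> \<partial>M) \<le> R * \<mu>"
      using small by eventually_elim (use main[OF T _ \<delta>] in \<open>auto simp: R_def\<close>)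
    have "((\<lambda>\<mu>. R * \<mu>) \<longlongrightarrow> R * 0) (at_right 0)"
      by (intro tendsto_intros)
    then show "((\<lambda>\<mu>. R * \<mu>) \<longlongrightarrow> 0) (at_right 0)" by simp
  qed simp
  show ?thesis
    using K(1) main lim unfolding D_def[abs_def] by blast
qed

end
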